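(* Let $\rho>0$, $m\in(-\sqrt\rho,\sqrt\rho)$, $\mu=-\frac m{\rho-m^2}$ and $\eta=\frac1{2(\rho-m^2)}$. Let $I\subset\Lambda$ be an index set of fixed size, and let $f:\mathbb{R}^{|I|}\to\mathbb{R}$ be either a bounded $1$-Lipschitz function with respect to $\|\cdot\|_2$, or a finite product of coordinates of finite order (a monomial $\prod_{\ell=1}^{k}y_{j_\ell}$ with $k$ fixed). Then \[ \langle f\circ P_I\rangle_{\mathrm{MC}}^{m,\rho;N}=\langle f\circ P_I\rangle_{\mathrm{GC}}^{\mu,\eta;N}+O(N^{-1/2}). \]
   Context: $\Lambda$ finite lattice, $N=|\Lambda|$, $\phi\in\mathbb{R}^\Lambda$, $M[\phi]=\sum_x\phi_x$, $N[\phi]=\sum_x\phi_x^2$; $P_I$ restricts to sites in $I$. $\mu_{\mathrm{MC}}^{m,\rho;N}$ is the normalized uniform surface measure on $\{M[\phi]=mN,\ N[\phi]=\rho N\}$. The auxiliary grand canonical ensemble $\mu_{\mathrm{GC}}^{\mu,\eta;N}$ ($\mu\in\mathbb{R}$, $\eta>0$) has density on $\mathbb{R}^N$ proportional to $e^{-\mu M[\phi]-\eta N[\phi]}$. *)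

theory Defs
  imports "HOL-Probability.Probability"
begin

text \<open>Lattice Lambda = {0..<N}; configurations phi are functions nat => real restricted
  to {..<N}; Lebesgue measure on R^N is the product measure PiM {..<N} (lambda _. lborel).\<close>

definition lebN :: "nat \<Rightarrow> (nat \<Rightarrow> real) measure" where
  "lebN n = PiM {..<n} (\<lambda>_. lborel)"

definition Mtot :: "nat \<Rightarrow> (nat \<Rightarrow> real) \<Rightarrow> real" where
  "Mtot n \<phi> = (\<Sum>x<n. \<phi> x)"

definition Nsq :: "nat \<Rightarrow> (nat \<Rightarrow> real) \<Rightarrow> real" where
  "Nsq n \<phi> = (\<Sum>x<n. (\<phi> x)\<^sup>2)"

definition gc_weight :: "nat \<Rightarrow> real \<Rightarrow> real \<Rightarrow> (nat \<Rightarrow> real) \<Rightarrow> real" where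
  "gc_weight n \<mu> \<eta> \<phi> = exp (- \<mu> * Mtot n \<phi> - \<eta> * Nsq n \<phi>)"

definition gc_measure :: "nat \<Rightarrow> real \<Rightarrow> real \<Rightarrow> (nat \<Rightarrow> real) measure" where
  "gc_measure n \<mu> \<eta> =
     density (lebN n) (\<lambda>\<phi>. ennreal (gc_weight n \<mu> \<eta> \<phi> /
                                   (\<integral>\<psi>. gc_weight n \<mu> \<eta> \<psi> \<partial>lebN n)))"

text \<open>Normalized uniform surface measure on the unit sphere of R^n, defined as the
  cone measure: sigma(A) = lambda(cone(A) inter ball)/lambda(ball), i.e. the image of the
  uniform probability on the closed unit ball under radial projection.\<close>
definition sphere_unif :: "nat \<Rightarrow> (nat \<Rightarrow> real) measure" where
  "sphere_unif n =
     distr (uniform_measure (lebN n) {x \<in> space (lebN n). Nsq n x \<le> 1})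
           (lebN n) (\<lambda>x. \<lambda>i\<in>{..<n}. x i / sqrt (Nsq n x))"

text \<open>Helmert orthonormal basis of the hyperplane orthogonal to (1,...,1) in R^N:
  vector k (k < N-1) has entries 1/sqrt(a(a+1)) at positions j < a, -a/sqrt(a(a+1)) at j = a,
  0 otherwise, where a = k+1.\<close>
definition helmert :: "nat \<Rightarrow> nat \<Rightarrow> real" where
  "helmert k j = (let a = real (k + 1) in
      if j < k + 1 then 1 / sqrt (a * (a + 1))
      else if j = k + 1 then - a / sqrt (a * (a + 1)) else 0)"

text \<open>Microcanonical ensemble: normalized uniform surface measure on
  {M = m N, N = rho N}, which is the (N-2)-sphere with centre (m,...,m) and radius
  sqrt(N(rho - m^2)) in the affine hyperplane {M = m N}; obtained as the image of the
  uniform measure on the unit sphere of R^(N-1) under the isometric embedding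
  y |-> m 1 + r sum_k y_k h_k.\<close>
definition mc_measure :: "nat \<Rightarrow> real \<Rightarrow> real \<Rightarrow> (nat \<Rightarrow> real) measure" where
  "mc_measure n m \<rho> =
     distr (sphere_unif (n - 1)) (lebN n)
       (\<lambda>y. \<lambda>j\<in>{..<n}. m + sqrt (real n * (\<rho> - m\<^sup>2)) * (\<Sum>k<n - 1. y k * helmert k j))"

text \<open>P_I phi as a vector of R^{|I|}, with I enumerated injectively by iota.\<close>
definition proj_I :: "('k::finite \<Rightarrow> nat) \<Rightarrow> (nat \<Rightarrow> real) \<Rightarrow> real ^ 'k" where
  "proj_I \<iota> \<phi> = (\<chi> i. \<phi> (\<iota> i))"

end

(*
  With sigma^2 = rho - m^2, the grand canonical ensemble is m + sigma Z with Z a standard Gaussian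
  vector in R^N.  Let x be the coordinates of Z in the orthonormal basis formed by the Helmert
  vectors and (1,...,1)/sqrt N; these are again independent standard Gaussians, because the change
  of basis is a product of plane rotations.  Write V for the component of Z orthogonal to (1,...,1),
  which depends only on the first N - 1 of them, x'.  Scaling of Lebesgue measure shows that x'/|x'|
  is uniform on the sphere and independent of |x'|, so the microcanonical ensemble is
  m + sigma sqrt N V/|x'|.  In this coupling the two fields differ at each site by
  (V_j/|x'|) (sqrt N - |x'|) minus the mean of Z, whose second moment is O(1/N): independence of
  direction and radius bounds the moments of V_j/|x'| by those of V_j, and Var |x'|^2 = O(N).
  All moments at a site are bounded uniformly in N, and Young's inequality with weight sqrt N
  turns this into the O(N^(-1/2)) bound for test functions of polynomial growth.
*)

theory Submission
  imports Defs
begin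

section \<open>Standard Gaussian vectors\<close>

text \<open>The obstacle is the division by the random radius |x'|, whose negative moments would be
  awkward. Independence removes them: with q = V_j/|x'| it gives E q^(2p) * E |x'|^(2p) = E
  V_j^(2p), so an upper bound on E q^(2p) needs only a lower bound on a positive moment of the
  radius, and convexity supplies one. The moments of V_j need no computation with Helmert entries,
  because V_j is the Gaussian Z_j minus the mean of Z. Defining the surface measure as a cone
  measure is what makes scaling sufficient: a function of the direction is homogeneous of degree 0,
  and the scaling of balls fixes how it pairs with any function of the radius, so no surface
  integral occurs. The sphere has radius sigma sqrt N whereas |x'|^2 has mean N - 1; this bias is of
  lower order than the fluctuation of |x'|^2. Moments of the fields are bounded as extended
  nonnegative integrals, so that finiteness is a by-product; their Bochner integrals enter only at
  the end.\<close>

definition std_gauss :: "real measure" where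
  "std_gauss = density lborel std_normal_density"

definition gaussN :: "nat \<Rightarrow> (nat \<Rightarrow> real) measure" where
  "gaussN n = PiM {..<n} (\<lambda>_. std_gauss)"

lemma sets_std_gauss [simp, measurable_cong]: "sets std_gauss = sets borel"
  by (simp add: std_gauss_def)

lemma space_std_gauss [simp]: "space std_gauss = UNIV"
  by (simp add: std_gauss_def)

interpretation std_gauss: prob_space std_gauss
  unfolding std_gauss_def by (rule prob_space_normal_density) simp

interpretation std_gauss_prod: product_prob_space "\<lambda>_::nat. std_gauss" UNIV
  by unfold_locales

interpretation lborel_prod: product_sigma_finite "\<lambda>_::nat. lborel :: real measure"
  by unfold_locales

lemma sets_lebN [measurable_cong]: "sets (lebN n) = sets (PiM {..<n} (\<lambda>_. borel))"
  unfolding lebN_def by (intro sets_PiM_cong) auto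

lemma sets_gaussN [measurable_cong]: "sets (gaussN n) = sets (lebN n)"
  unfolding lebN_def gaussN_def by (intro sets_PiM_cong) auto

lemma space_lebN [simp]: "space (lebN n) = PiE {..<n} (\<lambda>_. UNIV)"
  by (simp add: lebN_def space_PiM)

lemma space_gaussN [simp]: "space (gaussN n) = PiE {..<n} (\<lambda>_. UNIV)"
  by (simp add: gaussN_def space_PiM)

lemma prob_space_gaussN: "prob_space (gaussN n)"
  unfolding gaussN_def by (intro prob_space_PiM std_gauss.prob_space_axioms)

lemma measurable_component_lebN: "j < n \<Longrightarrow> (\<lambda>x. x j) \<in> borel_measurable (lebN n)"
  unfolding lebN_def by simp

lemma measurable_Nsq_le: "d \<le> n \<Longrightarrow> Nsq d \<in> borel_measurable (lebN n)"
  unfolding Nsq_def by measurable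

lemma measurable_Nsq [measurable]:
  "Nsq n \<in> borel_measurable (lebN n)" "Nsq n \<in> borel_measurable (gaussN n)"
  using measurable_Nsq_le[of n n] by (simp_all add: measurable_cong_sets[OF sets_gaussN refl])

lemma measurable_into_lebN:
  assumes "\<And>j. j < n \<Longrightarrow> (\<lambda>x. f x j) \<in> borel_measurable M"
    and "\<And>x. x \<in> space M \<Longrightarrow> f x \<in> extensional {..<n}"
  shows "f \<in> measurable M (lebN n)"
  unfolding lebN_def
  by (rule measurable_PiM_single') (use assms in \<open>auto simp: PiE_iff\<close>)

text \<open>Agreement on boxes suffices, and there Tonelli splits the integral into one-dimensional
  factors. It serves both the standard Gaussian and the grand canonical density.\<close>

lemma density_lebN_prod:
  assumes [measurable]: "g \<in> borel_measurable borel"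
    and nn: "\<And>x. 0 \<le> g x" and ps: "prob_space (density lborel (\<lambda>x. ennreal (g x)))"
  shows "density (lebN n) (\<lambda>x. ennreal (\<Prod>i<n. g (x i))) = PiM {..<n} (\<lambda>_. density lborel (\<lambda>x. ennreal (g x)))"
proof -
  let ?D = "density lborel (\<lambda>x. ennreal (g x))"
  interpret prob_space ?D by fact
  interpret product_sigma_finite "\<lambda>_::nat. ?D" by unfold_locales
  show ?thesis
  proof (rule PiM_eqI)
    show "sets (density (lebN n) (\<lambda>x. ennreal (\<Prod>i<n. g (x i)))) = sets (PiM {..<n} (\<lambda>_. ?D))"
      by (simp add: sets_lebN cong: sets_PiM_cong)
    fix A :: "nat \<Rightarrow> real set" assume "\<And>i. i \<in> {..<n} \<Longrightarrow> A i \<in> sets ?D"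
    then have A[measurable]: "\<And>i. i < n \<Longrightarrow> A i \<in> sets borel" by auto
    have "emeasure (density (lebN n) (\<lambda>x. ennreal (\<Prod>i<n. g (x i)))) (PiE {..<n} A)
      = (\<integral>\<^sup>+x. ennreal (\<Prod>i<n. g (x i)) * indicator (PiE {..<n} A) x \<partial>lebN n)"
      by (subst emeasure_density) (auto simp: lebN_def intro!: sets_PiM_I_finite)
    also have "\<dots> = (\<integral>\<^sup>+x. (\<Prod>i<n. ennreal (g (x i)) * indicator (A i) (x i)) \<partial>lebN n)"
    proof (rule nn_integral_cong)
      fix x assume "x \<in> space (lebN n)"
      then have "indicator (PiE {..<n} A) x = (\<Prod>i<n. indicator (A i) (x i) :: ennreal)"
        by (auto simp: indicator_def PiE_iff prod_zero_iff)
      then show "ennreal (\<Prod>i<n. g (x i)) * indicator (PiE {..<n} A) x = (\<Prod>i<n. ennreal (g (x i)) * indicator (A i) (x i))"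
        by (simp add: prod.distrib prod_ennreal nn)
    qed
    also have "\<dots> = (\<Prod>i<n. \<integral>\<^sup>+x. ennreal (g x) * indicator (A i) x \<partial>lborel)"
      unfolding lebN_def by (rule lborel_prod.product_nn_integral_prod) (auto intro!: borel_measurable_times_ennreal)
    also have "\<dots> = (\<Prod>i<n. emeasure ?D (A i))"
      by (intro prod.cong) (auto simp: emeasure_density)
    finally show "emeasure (density (lebN n) (\<lambda>x. ennreal (\<Prod>i<n. g (x i)))) (PiE {..<n} A) = (\<Prod>i<n. emeasure ?D (A i))" .
  qed simp
qed

text \<open>The point of this form is that the density depends on x only through
  \<open>Nsq n x\<close>; the polar argument rests on that.\<close>

lemma gaussN_eq_density:
  "gaussN n = density (lebN n) (\<lambda>x. ennreal ((1 / sqrt (2 * pi)) ^ n * exp (- Nsq n x / 2)))"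
proof -
  have "gaussN n = density (lebN n) (\<lambda>x. ennreal (\<Prod>i<n. std_normal_density (x i)))"
    unfolding gaussN_def std_gauss_def
    by (rule density_lebN_prod[symmetric]) (auto intro: prob_space_normal_density)
  also have "(\<lambda>x. \<Prod>i<n. std_normal_density (x i)) = (\<lambda>x. (1 / sqrt (2 * pi)) ^ n * exp (- Nsq n x / 2))"
    by (simp add: fun_eq_iff std_normal_density_def prod.distrib Nsq_def exp_sum
        sum_negf[symmetric] sum_divide_distrib prod_constant power_divide prod_dividef)
  finally show ?thesis .
qed

text \<open>Completing the square in each coordinate: the given relations between the parameters
  make every site Gaussian with mean m and standard deviation s.\<close>

lemma gc_measure_eq_PiM:
  assumes s: "0 < s" and mu: "\<mu> = - m / s\<^sup>2" and eta: "\<eta> = 1 / (2 * s\<^sup>2)"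
  shows "gc_measure n \<mu> \<eta> = PiM {..<n} (\<lambda>_. density lborel (\<lambda>x. ennreal (normal_density m s x)))"
proof -
  \<comment> \<open>The exponential is what completing the square leaves over, the root is the
    normalisation missing from the weight. The partition function is K^n, so K cancels.\<close>
  define K where "K = sqrt (2 * pi * s\<^sup>2) * exp (m\<^sup>2 / (2 * s\<^sup>2))"
  have K: "K > 0" using s by (simp add: K_def)
  have one: "exp (- \<mu> * t - \<eta> * t\<^sup>2) = K * normal_density m s t" for t
    using s by (simp add: K_def normal_density_def mu eta exp_add[symmetric] flip: exp_minus)
      (simp add: field_simps power2_eq_square)
  have w: "gc_weight n \<mu> \<eta> = (\<lambda>x. K ^ n * (\<Prod>i<n. normal_density m s (x i)))"
  proof
    fix x
    have "gc_weight n \<mu> \<eta> x = (\<Prod>i<n. exp (- \<mu> * x i - \<eta> * (x i)\<^sup>2))"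
      by (simp add: gc_weight_def Mtot_def Nsq_def exp_sum[symmetric] sum_distrib_left sum_subtractf sum_negf)
    then show "gc_weight n \<mu> \<eta> x = K ^ n * (\<Prod>i<n. normal_density m s (x i))"
      unfolding one by (simp add: prod.distrib)
  qed
  have "(\<integral>x. (\<Prod>i<n. normal_density m s (x i)) \<partial>lebN n) = (\<Prod>i<n. \<integral>x. normal_density m s x \<partial>lborel)"
    unfolding lebN_def using s by (intro lborel_prod.product_integral_prod) auto
  then have "(\<integral>x. (\<Prod>i<n. normal_density m s (x i)) \<partial>lebN n) = 1"
    using s by simp
  then have "gc_measure n \<mu> \<eta> = density (lebN n) (\<lambda>x. ennreal (\<Prod>i<n. normal_density m s (x i)))"
    using K by (simp add: gc_measure_def w)
  also have "\<dots> = PiM {..<n} (\<lambda>_. density lborel (\<lambda>x. ennreal (normal_density m s x)))"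
    using s by (intro density_lebN_prod) (auto intro: prob_space_normal_density)
  finally show ?thesis .
qed

lemma gc_measure_eq_distr:
  assumes s: "0 < s" and mu: "\<mu> = - m / s\<^sup>2" and eta: "\<eta> = 1 / (2 * s\<^sup>2)"
  shows "gc_measure n \<mu> \<eta> = distr (gaussN n) (lebN n) (\<lambda>x. \<lambda>j\<in>{..<n}. m + s * x j)"
proof -
  have "density lborel (\<lambda>x. ennreal (normal_density m s x)) = distr std_gauss borel (\<lambda>x. m + s * x)"
  proof -
    have "distributed std_gauss lborel (\<lambda>x. x) (\<lambda>x. ennreal (std_normal_density x))"
      by (auto simp: distributed_def std_gauss_def distr_id2)
    from std_gauss.normal_density_affine[OF this, of s m] s
    have "distributed std_gauss lborel (\<lambda>x. m + s * x) (normal_density m s)" by simp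
    then have "distr std_gauss lborel (\<lambda>x. m + s * x) = density lborel (\<lambda>x. ennreal (normal_density m s x))"
      by (simp add: distributed_def)
    moreover have "distr std_gauss lborel (\<lambda>x. m + s * x) = distr std_gauss borel (\<lambda>x. m + s * x)"
      by (rule distr_cong) auto
    ultimately show ?thesis by simp
  qed
  \<comment> \<open>The target of \<open>distr\<close> matters only through its space and sets, so
    \<open>std_gauss\<close> can replace \<open>borel\<close>; the product rule below is then
    applied with a probability space as target.\<close>
  moreover have "distr std_gauss borel (\<lambda>x. m + s * x) = distr std_gauss std_gauss (\<lambda>x. m + s * x)"
    by (rule distr_cong) auto
  ultimately have "gc_measure n \<mu> \<eta> = PiM {..<n} (\<lambda>_. distr std_gauss std_gauss (\<lambda>x. m + s * x))"
    using gc_measure_eq_PiM[OF assms] by simp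
  also have "\<dots> = distr (gaussN n) (gaussN n) (compose {..<n} (\<lambda>x. m + s * x))"
    unfolding gaussN_def
    by (rule distr_PiM_finite_prob_space'[symmetric])
       (auto intro!: std_gauss.prob_space_axioms simp: measurable_cong_sets[OF sets_std_gauss sets_std_gauss])
  also have "\<dots> = distr (gaussN n) (lebN n) (\<lambda>x. \<lambda>j\<in>{..<n}. m + s * x j)"
    by (rule distr_cong) (auto simp: sets_gaussN compose_def)
  finally show ?thesis .
qed

section \<open>Rotation invariance and the Helmert basis\<close>

lemma nn_integral_std_gauss:
  "f \<in> borel_measurable borel \<Longrightarrow>
    (\<integral>\<^sup>+x. f x \<partial>std_gauss) = (\<integral>\<^sup>+x. ennreal (std_normal_density x) * f x \<partial>lborel)"
  unfolding std_gauss_def by (subst nn_integral_density) auto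

lemma std_normal_density_rotate:
  assumes "a\<^sup>2 + b\<^sup>2 = 1"
  shows "std_normal_density (a * s - b * y) * std_normal_density (b * s + a * y)
    = std_normal_density s * std_normal_density y"
proof -
  have "(a * s - b * y)\<^sup>2 + (b * s + a * y)\<^sup>2 = (a\<^sup>2 + b\<^sup>2) * (s\<^sup>2 + y\<^sup>2)"
    by (simp add: power2_eq_square algebra_simps)
  then have e: "- (a * s - b * y)\<^sup>2 / 2 + - (b * s + a * y)\<^sup>2 / 2 = - s\<^sup>2 / 2 + - y\<^sup>2 / 2"
    using assms by simp
  have "exp (- (a * s - b * y)\<^sup>2 / 2) * exp (- (b * s + a * y)\<^sup>2 / 2) = exp (- s\<^sup>2 / 2) * exp (- y\<^sup>2 / 2)"
    unfolding exp_add[symmetric] e ..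
  then show ?thesis by (simp add: std_normal_density_def)
qed

text \<open>Two one-dimensional affine substitutions suffice: first \<open>s \<mapsto> a s - b y\<close> for fixed
  \<open>y\<close>, then \<open>y \<mapsto> (b u + y) / a\<close> for fixed \<open>u\<close>.\<close>

lemma nn_integral_gauss_rotate:
  assumes [measurable]: "case_prod \<psi> \<in> borel_measurable (borel \<Otimes>\<^sub>M borel)"
    and a: "a > 0" and ab: "a\<^sup>2 + b\<^sup>2 = 1"
  shows "(\<integral>\<^sup>+y. \<integral>\<^sup>+s. \<psi> (a * s - b * y) (b * s + a * y) \<partial>std_gauss \<partial>std_gauss)
    = (\<integral>\<^sup>+y. \<integral>\<^sup>+s. \<psi> s y \<partial>std_gauss \<partial>std_gauss)"
proof -
  let ?\<phi> = "\<lambda>x. ennreal (std_normal_density x)"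
  define G where "G u v = ?\<phi> u * ?\<phi> v * \<psi> u v" for u v
  have [measurable]: "case_prod G \<in> borel_measurable (borel \<Otimes>\<^sub>M borel)"
    unfolding G_def by measurable
  have red: "(\<integral>\<^sup>+y. \<integral>\<^sup>+s. h s y \<partial>std_gauss \<partial>std_gauss) = (\<integral>\<^sup>+y. \<integral>\<^sup>+s. ?\<phi> s * ?\<phi> y * h s y \<partial>lborel \<partial>lborel)"
    if [measurable]: "case_prod h \<in> borel_measurable (borel \<Otimes>\<^sub>M borel)" for h
    by (simp add: nn_integral_std_gauss nn_integral_cmult[symmetric] mult_ac)
  have a2: "b * (b * y) + a * (a * y) = y" for y
  proof -
    have "b * (b * y) + a * (a * y) = (a\<^sup>2 + b\<^sup>2) * y"
      by (simp add: power2_eq_square algebra_simps)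
    then show ?thesis using ab by simp
  qed
  have "(\<integral>\<^sup>+y. \<integral>\<^sup>+s. \<psi> (a * s - b * y) (b * s + a * y) \<partial>std_gauss \<partial>std_gauss)
    = (\<integral>\<^sup>+y. \<integral>\<^sup>+s. G (a * s - b * y) (b * s + a * y) \<partial>lborel \<partial>lborel)"
    by (subst red) (auto simp: G_def ennreal_mult[symmetric] std_normal_density_rotate[OF ab])
  also have "\<dots> = (\<integral>\<^sup>+y. ennreal (1/a) * (\<integral>\<^sup>+u. G u ((b * u + y) / a) \<partial>lborel) \<partial>lborel)"
  proof (rule nn_integral_cong)
    fix y
    have e1: "a * (b * y / a + 1 / a * u) - b * y = u" for u
      using a by (simp add: field_simps)
    \<comment> \<open>With s = (u + b y)/a the coefficient of y becomes (b^2 + a^2)/a; here the unit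
      length of (a, b) enters the substitution.\<close>
    have e2: "b * (b * y / a + 1 / a * u) + a * y = (b * u + y) / a" for u
      using a a2[of y] by (simp add: field_simps)
    show "(\<integral>\<^sup>+s. G (a * s - b * y) (b * s + a * y) \<partial>lborel) = ennreal (1/a) * (\<integral>\<^sup>+u. G u ((b * u + y) / a) \<partial>lborel)"
      using a by (subst nn_integral_real_affine[where c="1/a" and t="b * y / a"]) (simp_all only: e1 e2, auto)
  qed
  also have "\<dots> = ennreal (1/a) * (\<integral>\<^sup>+y. \<integral>\<^sup>+u. G u ((b * u + y) / a) \<partial>lborel \<partial>lborel)"
    by (rule nn_integral_cmult) measurable
  also have "(\<integral>\<^sup>+y. \<integral>\<^sup>+u. G u ((b * u + y) / a) \<partial>lborel \<partial>lborel) = (\<integral>\<^sup>+u. \<integral>\<^sup>+y. G u ((b * u + y) / a) \<partial>lborel \<partial>lborel)"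
    by (rule lborel_pair.Fubini') measurable
  also have "\<dots> = (\<integral>\<^sup>+u. ennreal a * (\<integral>\<^sup>+v. G u v \<partial>lborel) \<partial>lborel)"
  proof (rule nn_integral_cong)
    fix u
    have e1: "(b * u + (- b * u + a * v)) / a = v" for v
      using a by (simp add: field_simps)
    show "(\<integral>\<^sup>+y. G u ((b * u + y) / a) \<partial>lborel) = ennreal a * (\<integral>\<^sup>+v. G u v \<partial>lborel)"
      using a by (subst nn_integral_real_affine[where c="a" and t="- b * u"]) (auto simp: e1[simplified])
  qed
  also have "\<dots> = ennreal a * (\<integral>\<^sup>+u. \<integral>\<^sup>+v. G u v \<partial>lborel \<partial>lborel)"
    by (rule nn_integral_cmult) measurable
  also have "(\<integral>\<^sup>+u. \<integral>\<^sup>+v. G u v \<partial>lborel \<partial>lborel) = (\<integral>\<^sup>+v. \<integral>\<^sup>+u. G u v \<partial>lborel \<partial>lborel)"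
    by (rule lborel_pair.Fubini') measurable
  \<comment> \<open>The Jacobians 1/a and a of the two substitutions cancel.\<close>
  also have "ennreal (1 / a) * (ennreal a * \<dots>) = (ennreal (1 / a) * ennreal a) * \<dots>"
    by (simp only: mult.assoc)
  also have "ennreal (1 / a) * ennreal a = 1"
    using a by (simp add: ennreal_mult[symmetric])
  finally show ?thesis
    by (subst red) (auto simp: G_def)
qed

section \<open>Helmert coordinates and their recursion in the number of sites\<close>

definition hsum :: "nat \<Rightarrow> (nat \<Rightarrow> real) \<Rightarrow> real" where
  "hsum n z = (\<Sum>j<n. z j) / sqrt (real n)"

text \<open>The inner product of z with the k-th Helmert vector, written through a partial sum so
  that the recursion in n becomes visible.\<close>

definition hcoef :: "nat \<Rightarrow> (nat \<Rightarrow> real) \<Rightarrow> real" where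
  "hcoef k z = ((\<Sum>j<k+1. z j) - real (k + 1) * z (k + 1)) / sqrt (real (k + 1) * real (k + 2))"

text \<open>The coordinate along (1,...,1)/sqrt n comes last: the first n - 1 then describe the
  orthogonal component, and a new site only mixes with the last one.\<close>

definition hmap :: "nat \<Rightarrow> (nat \<Rightarrow> real) \<Rightarrow> (nat \<Rightarrow> real)" where
  "hmap n z = (\<lambda>k\<in>{..<n}. if k < n - 1 then hcoef k z else hsum n z)"

text \<open>Entry j of the vector with Helmert coordinates x; for d = n - 1 this is the component
  orthogonal to (1,...,1).\<close>

definition hinv :: "nat \<Rightarrow> (nat \<Rightarrow> real) \<Rightarrow> nat \<Rightarrow> real" where
  "hinv d x j = (\<Sum>k<d. x k * helmert k j)"

text \<open>Together with \<open>hsum_rec\<close>: the pair (\<open>hsum n z\<close>,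
  \<open>z n\<close>) is turned into the new Helmert coordinate and the new normalised sum by a
  plane rotation with cosine 1/sqrt (n + 1).\<close>

lemma hcoef_rec:
  assumes "n \<ge> 1"
  shows "hcoef (n - 1) z = 1 / sqrt (real (n + 1)) * hsum n z - sqrt (real n / real (n + 1)) * z n"
proof -
  from assms obtain k where n: "n = Suc k" by (cases n) auto
  define p where "p = sqrt (real n)"
  have p: "p > 0" "p * p = real n" using assms by (auto simp: p_def)
  have q: "sqrt (real (n + 1)) > 0" by simp
  have "hcoef (n - 1) z = ((\<Sum>j<n. z j) - real n * z n) / (p * sqrt (real (n + 1)))"
    unfolding hcoef_def p_def n by (simp add: real_sqrt_mult add_ac)
  also have "\<dots> = 1 / sqrt (real (n + 1)) * hsum n z - sqrt (real n / real (n + 1)) * z n"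
    unfolding hsum_def real_sqrt_divide p_def[symmetric] unfolding p(2)[symmetric] using p q
    by (simp add: field_simps)
  finally show ?thesis .
qed

lemma hsum_rec:
  "n \<ge> 1 \<Longrightarrow> hsum (Suc n) z = sqrt (real n / real (n + 1)) * hsum n z + 1 / sqrt (real (n + 1)) * z n"
  by (simp add: hsum_def real_sqrt_divide field_simps)

lemma hrot_unit: "(1 / sqrt (real (n + 1)))\<^sup>2 + (sqrt (real n / real (n + 1)))\<^sup>2 = 1"
  by (simp add: power_divide field_simps)

text \<open>Induction along the rotations replaces the orthogonality relations of the Helmert
  vectors.\<close>

lemma hmap_inverse:
  "n \<ge> 1 \<Longrightarrow> j < n \<Longrightarrow> hinv (n - 1) (\<lambda>k. hcoef k z) j + hsum n z / sqrt (real n) = z j"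
proof (induction n rule: nat_induct_at_least)
  case base
  then show ?case by (simp add: hsum_def hinv_def)
next
  case (Suc n)
  define p q where "p = sqrt (real n)" and "q = sqrt (real (n + 1))"
  have p: "p > 0" "p * p = real n" and q: "q > 0" "q * q = real n + 1"
    using Suc.hyps by (auto simp: p_def q_def)
  have r1: "hcoef (n - 1) z = 1 / q * hsum n z - p / q * z n"
    using hcoef_rec[OF Suc.hyps, of z] by (simp add: p_def q_def real_sqrt_divide)
  have r2: "hsum (Suc n) z = p / q * hsum n z + 1 / q * z n"
    using hsum_rec[OF Suc.hyps, of z] by (simp add: p_def q_def real_sqrt_divide)
  have e: "hinv (Suc n - 1) (\<lambda>k. hcoef k z) j = hinv (n - 1) (\<lambda>k. hcoef k z) j + hcoef (n - 1) z * helmert (n - 1) j"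
    using Suc.hyps by (cases n) (auto simp: hinv_def)
  have n1: "n - 1 + 1 = n" using Suc.hyps by auto
  have hl: "helmert (n - 1) j = (if j < n then 1 / (p * q) else - p / q)"
  proof -
    have pn: "sqrt (real n) = p" "real n = p * p" using p by (auto simp: p_def)
    have qn: "sqrt (real n + 1) = q" by (simp add: q_def add.commute)
    show ?thesis
      using Suc.prems p q
      unfolding helmert_def Let_def n1 real_sqrt_mult pn(1) qn
      by (auto simp: pn(2))
  qed
  have qS: "sqrt (real (Suc n)) = q" by (simp add: q_def)
  show ?case
  proof (cases "j < n")
    case True
    have qq: "q * q = p * p + 1" using p q by simp
    \<comment> \<open>At an old site the share of the new Helmert vector plus the new mean must give
      back the old mean S / p. Here S stands for \<open>hsum n z\<close> and y for
      \<open>z n\<close>.\<close>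
    have "(1 / q * S - p / q * y) * (1 / (p * q)) + (p / q * S + 1 / q * y) / q = S / p" for S y
    proof -
      have "(1 / q * S - p / q * y) * (1 / (p * q)) + (p / q * S + 1 / q * y) / q = S * (p * p + 1) / (p * (q * q))"
      proof -
        have "p \<noteq> 0" "q \<noteq> 0" using p(1) q(1) by auto
        then show ?thesis by (simp add: divide_simps) (simp add: algebra_simps)
      qed
      then show ?thesis unfolding qq[symmetric] using q(1) by simp
    qed
    then show ?thesis
      using Suc.IH[OF True] unfolding e r1 r2 hl qS if_P[OF True] p_def[symmetric] add.assoc by simp
  next
    case False
    then have j: "j = n" using Suc.prems by simp
    have hl': "helmert (n - 1) n = - p / q" using hl unfolding j by simp
    \<comment> \<open>All older Helmert vectors vanish at the new site n, so only the newest one and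
      the mean contribute.\<close>
    have "hinv (n - 1) (\<lambda>k. hcoef k z) n = 0"
      unfolding hinv_def by (intro sum.neutral) (auto simp: helmert_def Let_def)
    moreover have "(1 / q * S - p / q * y) * (- p / q) + (p / q * S + 1 / q * y) / q = y" for S y
    proof -
      have "(1 / q * S - p / q * y) * (- p / q) + (p / q * S + 1 / q * y) / q = y * (p * p + 1) / (q * q)"
      proof -
        have "q \<noteq> 0" using q(1) by auto
        then show ?thesis by (simp add: divide_simps) (simp add: algebra_simps)
      qed
      then show ?thesis using p q by simp
    qed
    ultimately show ?thesis
      unfolding j e[unfolded j] r1 r2 hl' qS by simp
  qed
qed

text \<open>The inductive step of the invariance proof: a new site with value y is rotated with the
  old last coordinate. \<open>Suc m\<close> sites are assumed so that this coordinate has the index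
  m.\<close>

lemma hmap_Suc:
  "hmap (Suc (Suc m)) (z(Suc m := y)) =
    (hmap (Suc m) z)(m := 1 / sqrt (real (Suc m + 1)) * hmap (Suc m) z m - sqrt (real (Suc m) / real (Suc m + 1)) * y,
              Suc m := sqrt (real (Suc m) / real (Suc m + 1)) * hmap (Suc m) z m + 1 / sqrt (real (Suc m + 1)) * y)"
proof -
  have h: "hsum (Suc m) (z(Suc m := y)) = hsum (Suc m) z"
    by (simp add: hsum_def)
  have k: "hcoef k (z(Suc m := y)) = hcoef k z" if "k < m" for k
    using that by (simp add: hcoef_def)
  show ?thesis
    using hcoef_rec[of "Suc m" "z(Suc m := y)"] hsum_rec[of "Suc m" "z(Suc m := y)"] 
    unfolding h by (auto simp: hmap_def fun_eq_iff k)
qed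

lemma measurable_hcoef [measurable]: "k + 1 < n \<Longrightarrow> hcoef k \<in> borel_measurable (lebN n)"
  unfolding hcoef_def by measurable

lemma measurable_hsum [measurable]: "hsum n \<in> borel_measurable (lebN n)"
  unfolding hsum_def by measurable

lemma measurable_hmap [measurable]: "hmap n \<in> measurable (lebN n) (lebN n)"
proof (rule measurable_into_lebN)
  fix j assume "j < n"
  then show "(\<lambda>x. hmap n x j) \<in> borel_measurable (lebN n)"
    by (cases "j < n - 1") (auto simp: hmap_def)
qed (auto simp: hmap_def)

text \<open>Both orders are recorded: the induction below keeps the new site outermost, and isolates
  the last old coordinate innermost.\<close>

lemma nn_integral_gaussN_Suc:
  assumes [measurable]: "f \<in> borel_measurable (lebN (Suc n))"
  shows "(\<integral>\<^sup>+x. f x \<partial>gaussN (Suc n)) = (\<integral>\<^sup>+x. \<integral>\<^sup>+y. f (x(n := y)) \<partial>std_gauss \<partial>gaussN n)"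
    and "(\<integral>\<^sup>+x. f x \<partial>gaussN (Suc n)) = (\<integral>\<^sup>+y. \<integral>\<^sup>+x. f (x(n := y)) \<partial>gaussN n \<partial>std_gauss)"
proof -
  have "f \<in> borel_measurable (gaussN (Suc n))"
    by (simp add: measurable_cong_sets[OF sets_gaussN refl])
  then have m: "f \<in> borel_measurable (Pi\<^sub>M (insert n {..<n}) (\<lambda>_. std_gauss))"
    by (simp add: gaussN_def lessThan_Suc)
  show "(\<integral>\<^sup>+x. f x \<partial>gaussN (Suc n)) = (\<integral>\<^sup>+x. \<integral>\<^sup>+y. f (x(n := y)) \<partial>std_gauss \<partial>gaussN n)"
    unfolding gaussN_def lessThan_Suc
    by (rule std_gauss_prod.product_nn_integral_insert[OF _ _ m]) auto
  show "(\<integral>\<^sup>+x. f x \<partial>gaussN (Suc n)) = (\<integral>\<^sup>+y. \<integral>\<^sup>+x. f (x(n := y)) \<partial>gaussN n \<partial>std_gauss)"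
    unfolding gaussN_def lessThan_Suc
    by (rule std_gauss_prod.product_nn_integral_insert_rev[OF _ _ m]) auto
qed

text \<open>For a fixed value y of the new site, the hypothesis replaces the old Helmert coordinates
  by independent Gaussians; the planar lemma then absorbs the rotation of the last of them with y.
  The function is arbitrary in the induction because it is composed with that rotation.\<close>

lemma nn_integral_hmap:
  assumes "n \<ge> 1" and "\<phi> \<in> borel_measurable (lebN n)"
  shows "(\<integral>\<^sup>+z. \<phi> (hmap n z) \<partial>gaussN n) = (\<integral>\<^sup>+z. \<phi> z \<partial>gaussN n)"
  using assms
proof (induction n arbitrary: \<phi> rule: nat_induct_at_least)
  case base
  have "hmap 1 z = z" if "z \<in> space (gaussN 1)" for z
    using that by (auto simp: hmap_def fun_eq_iff hsum_def PiE_iff extensional_def)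
  then show ?case
    by (intro nn_integral_cong) (simp del: space_gaussN)
next
  case (Suc n)
  note [measurable] = Suc.prems
  obtain m where n: "n = Suc m" using Suc.hyps by (cases n) auto
  define a b where "a = 1 / sqrt (real (Suc m + 1))" and "b = sqrt (real (Suc m) / real (Suc m + 1))"
  have ab: "a > 0" "a\<^sup>2 + b\<^sup>2 = 1"
    unfolding a_def b_def using hrot_unit[of "Suc m"] by auto
  define rot where "rot w y = w(m := a * w m - b * y, Suc m := b * w m + a * y)" for w :: "nat \<Rightarrow> real" and y
  define emb where "emb v s y = v(m := s, Suc m := y)" for v :: "nat \<Rightarrow> real" and s y
  interpret gm: prob_space "gaussN m" by (rule prob_space_gaussN)
  interpret pg: pair_sigma_finite "gaussN m" std_gauss ..
  have hm: "hmap (Suc n) (z(n := y)) = rot (hmap n z) y" for z y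
    unfolding n rot_def a_def b_def by (rule hmap_Suc)
  have [measurable]: "(\<lambda>(w, y). rot w y) \<in> measurable (lebN (Suc m) \<Otimes>\<^sub>M borel) (lebN (Suc n))"
    unfolding n
  proof (rule measurable_into_lebN)
    fix j assume j: "j < Suc (Suc m)"
    consider "j < m" | "j = m" | "j = Suc m" using j by linarith
    then show "(\<lambda>x. (case x of (w, y) \<Rightarrow> rot w y) j) \<in> borel_measurable (lebN (Suc m) \<Otimes>\<^sub>M borel)"
      by cases (auto simp: rot_def case_prod_beta)
  qed (auto simp: rot_def space_pair_measure PiE_iff extensional_def)
  have [measurable]: "(\<lambda>((v, s), y). emb v s y) \<in> measurable ((gaussN m \<Otimes>\<^sub>M borel) \<Otimes>\<^sub>M borel) (lebN (Suc n))"
    unfolding n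
  proof (rule measurable_into_lebN)
    fix j assume j: "j < Suc (Suc m)"
    consider "j < m" | "j = m" | "j = Suc m" using j by linarith
    then show "(\<lambda>x. (case x of (x, y) \<Rightarrow> (case x of (v, s) \<Rightarrow> emb v s) y) j)
        \<in> borel_measurable ((gaussN m \<Otimes>\<^sub>M borel) \<Otimes>\<^sub>M borel)"
      by cases (auto simp: emb_def case_prod_beta)
  qed (auto simp: emb_def space_pair_measure PiE_iff extensional_def)
  have emb_meas: "(\<lambda>x. emb (v x) (s x) (y x)) \<in> measurable M (lebN (Suc n))"
    if [measurable]: "v \<in> measurable M (gaussN m)" "s \<in> borel_measurable M" "y \<in> borel_measurable M" for v s y and M :: "'z measure"
  proof -
    have "(\<lambda>x. (\<lambda>((v, s), y). emb v s y) ((v x, s x), y x)) \<in> measurable M (lebN (Suc n))"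
      by measurable
    then show ?thesis by simp
  qed
  have rot_meas: "(\<lambda>w. rot w y) \<in> measurable (lebN (Suc m)) (lebN (Suc n))" for y
  proof -
    have "(\<lambda>w. (\<lambda>(w, y). rot w y) (w, y)) \<in> measurable (lebN (Suc m)) (lebN (Suc n))"
      by measurable
    then show ?thesis by simp
  qed
  note [measurable] = emb_meas rot_meas
  have "(\<integral>\<^sup>+z. \<phi> (hmap (Suc n) z) \<partial>gaussN (Suc n)) = (\<integral>\<^sup>+y. \<integral>\<^sup>+z. \<phi> (rot (hmap n z) y) \<partial>gaussN n \<partial>std_gauss)"
    by (subst nn_integral_gaussN_Suc(2)) (auto simp: hm)
  also have "\<dots> = (\<integral>\<^sup>+y. \<integral>\<^sup>+w. \<phi> (rot w y) \<partial>gaussN n \<partial>std_gauss)"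
    by (intro nn_integral_cong Suc.IH) (simp add: n)
  also have "\<dots> = (\<integral>\<^sup>+y. \<integral>\<^sup>+v. \<integral>\<^sup>+s. \<phi> (rot (v(m := s)) y) \<partial>std_gauss \<partial>gaussN m \<partial>std_gauss)"
    unfolding n by (intro nn_integral_cong nn_integral_gaussN_Suc(1)) (simp add: n[symmetric], measurable, simp add: n)
  also have "\<dots> = (\<integral>\<^sup>+y. \<integral>\<^sup>+v. \<integral>\<^sup>+s. \<phi> (emb v (a * s - b * y) (b * s + a * y)) \<partial>std_gauss \<partial>gaussN m \<partial>std_gauss)"
    by (simp add: rot_def emb_def)
  \<comment> \<open>The planar lemma acts on two adjacent integrals, over s and y, so the unaffected
    coordinates v are moved outside, and moved back afterwards.\<close>
  also have "\<dots> = (\<integral>\<^sup>+v. \<integral>\<^sup>+y. \<integral>\<^sup>+s. \<phi> (emb v (a * s - b * y) (b * s + a * y)) \<partial>std_gauss \<partial>std_gauss \<partial>gaussN m)"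
    by (rule pg.Fubini') measurable
  also have "\<dots> = (\<integral>\<^sup>+v. \<integral>\<^sup>+y. \<integral>\<^sup>+s. \<phi> (emb v s y) \<partial>std_gauss \<partial>std_gauss \<partial>gaussN m)"
    by (intro nn_integral_cong nn_integral_gauss_rotate[OF _ ab]) measurable
  also have "\<dots> = (\<integral>\<^sup>+y. \<integral>\<^sup>+v. \<integral>\<^sup>+s. \<phi> (emb v s y) \<partial>std_gauss \<partial>gaussN m \<partial>std_gauss)"
    by (rule pg.Fubini'[symmetric]) measurable
  also have "\<dots> = (\<integral>\<^sup>+y. \<integral>\<^sup>+w. \<phi> (w(n := y)) \<partial>gaussN n \<partial>std_gauss)"
  proof (rule nn_integral_cong)
    fix y
    have "(\<lambda>w. w(n := y)) \<in> measurable (lebN (Suc m)) (lebN (Suc n))"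
      by (rule measurable_into_lebN) (auto simp: n less_Suc_eq PiE_iff extensional_def)
    then have "(\<lambda>w. \<phi> (w(n := y))) \<in> borel_measurable (lebN (Suc m))"
      by measurable
    from nn_integral_gaussN_Suc(1)[OF this]
    show "(\<integral>\<^sup>+v. \<integral>\<^sup>+s. \<phi> (emb v s y) \<partial>std_gauss \<partial>gaussN m) = (\<integral>\<^sup>+w. \<phi> (w(n := y)) \<partial>gaussN n)"
      by (simp add: n emb_def)
  qed
  also have "\<dots> = (\<integral>\<^sup>+z. \<phi> z \<partial>gaussN (Suc n))"
    by (rule nn_integral_gaussN_Suc(2)[symmetric]) measurable
  finally show ?case .
qed

lemma distr_gaussN_hmap: "n \<ge> 1 \<Longrightarrow> distr (gaussN n) (lebN n) (hmap n) = gaussN n"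
proof (rule measure_eqI)
  fix A assume n: "n \<ge> 1" and "A \<in> sets (distr (gaussN n) (lebN n) (hmap n))"
  then have [measurable]: "A \<in> sets (lebN n)" by simp
  have "emeasure (distr (gaussN n) (lebN n) (hmap n)) A = (\<integral>\<^sup>+z. indicator A z \<partial>distr (gaussN n) (lebN n) (hmap n))"
    by simp
  also have "\<dots> = (\<integral>\<^sup>+z. indicator A (hmap n z) \<partial>gaussN n)"
    by (rule nn_integral_distr) measurable
  also have "\<dots> = emeasure (gaussN n) A"
    by (subst nn_integral_hmap[OF n]) (auto simp: sets_gaussN)
  finally show "emeasure (distr (gaussN n) (lebN n) (hmap n)) A = emeasure (gaussN n) A" .
qed (simp add: sets_gaussN)

section \<open>Polar decomposition of Lebesgue measure\<close>

text \<open>One linear substitution per coordinate. Induction runs over finite index sets because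
  the product integral is peeled off by \<open>insert\<close>.\<close>

lemma nn_integral_PiM_lborel_scale:
  assumes "finite J" and c: "c > 0" and "f \<in> borel_measurable (PiM J (\<lambda>_. lborel))"
  shows "(\<integral>\<^sup>+x. f x \<partial>PiM J (\<lambda>_::nat. lborel)) =
    ennreal (c ^ card J) * (\<integral>\<^sup>+x. f (\<lambda>i\<in>J. c * x i) \<partial>PiM J (\<lambda>_. lborel :: real measure))"
  using assms(1,3)
proof (induction J arbitrary: f rule: finite_induct)
  case empty
  \<comment> \<open>The only point of the empty product is \<open>undefined\<close> everywhere, and
    scaling fixes it.\<close>
  have "(\<lambda>x. undefined) = (\<lambda>i\<in>{}. c * x i)" for x :: "nat \<Rightarrow> real" by auto
  then show ?case
    by (simp add: PiM_empty nn_integral_count_space_finite)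
next
  case (insert i J)
  note [measurable] = insert.prems
  let ?L = "\<lambda>J. PiM J (\<lambda>_::nat. lborel :: real measure)"
  have upd: "(\<lambda>x. f (x(i := t))) \<in> borel_measurable (?L J)" for t
  proof -
    have "(\<lambda>x. x(i := t)) \<in> measurable (?L J) (?L (insert i J))"
      by (rule measurable_fun_upd[where J=J]) auto
    then show ?thesis by measurable
  qed
  have resc: "(\<lambda>x. \<lambda>i\<in>insert i J. c * x i) \<in> measurable (?L (insert i J)) (?L (insert i J))"
    by measurable
  have m2: "(\<lambda>x. f (\<lambda>i\<in>insert i J. c * x i)) \<in> borel_measurable (?L (insert i J))"
    using resc by measurable
  have m3: "(\<lambda>y. \<integral>\<^sup>+x. f (x(i := y)) \<partial>?L J) \<in> borel_measurable borel"
  proof -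
    interpret J: sigma_finite_measure "?L J"
      by (rule lborel_prod.sigma_finite) fact
    have "(\<lambda>(y, x). x(i := y)) \<in> measurable (borel \<Otimes>\<^sub>M ?L J) (?L (insert i J))"
      unfolding case_prod_beta by (rule measurable_fun_upd[where J=J]) auto
    then have "(\<lambda>p. f ((\<lambda>(y, x). x(i := y)) p)) \<in> borel_measurable (borel \<Otimes>\<^sub>M ?L J)"
      by measurable
    then show ?thesis
      by (intro J.borel_measurable_nn_integral) (simp add: case_prod_beta)
  qed
  have "(\<integral>\<^sup>+x. f x \<partial>?L (insert i J)) = (\<integral>\<^sup>+y. \<integral>\<^sup>+x. f (x(i := y)) \<partial>?L J \<partial>lborel)"
    using insert by (intro lborel_prod.product_nn_integral_insert_rev) auto
  also have "\<dots> = ennreal c * (\<integral>\<^sup>+y. \<integral>\<^sup>+x. f (x(i := c * y)) \<partial>?L J \<partial>lborel)"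
    using c by (subst nn_integral_real_affine[where c=c and t=0]) (use m3 in auto)
  also have "(\<integral>\<^sup>+y. \<integral>\<^sup>+x. f (x(i := c * y)) \<partial>?L J \<partial>lborel)
    = (\<integral>\<^sup>+y. ennreal (c ^ card J) * (\<integral>\<^sup>+x. f ((\<lambda>i\<in>J. c * x i)(i := c * y)) \<partial>?L J) \<partial>lborel)"
    by (intro nn_integral_cong insert.IH upd)
  also have "\<dots> = (\<integral>\<^sup>+y. ennreal (c ^ card J) * (\<integral>\<^sup>+x. f (\<lambda>j\<in>insert i J. c * (x(i := y)) j) \<partial>?L J) \<partial>lborel)"
  proof -
    have "(\<lambda>i\<in>J. c * x i)(i := c * y) = (\<lambda>j\<in>insert i J. c * (x(i := y)) j)" for x :: "nat \<Rightarrow> real" and y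
      using insert.hyps by (auto simp: fun_eq_iff restrict_def)
    then show ?thesis by simp
  qed
  also have "\<dots> = ennreal (c ^ card J) * (\<integral>\<^sup>+y. \<integral>\<^sup>+x. f (\<lambda>j\<in>insert i J. c * (x(i := y)) j) \<partial>?L J \<partial>lborel)"
  proof (rule nn_integral_cmult)
    interpret J: sigma_finite_measure "?L J"
      by (rule lborel_prod.sigma_finite) fact
    have "(\<lambda>(y, x). x(i := y)) \<in> measurable (borel \<Otimes>\<^sub>M ?L J) (?L (insert i J))"
      unfolding case_prod_beta by (rule measurable_fun_upd[where J=J]) auto
    from measurable_compose[OF this m2] 
    show "(\<lambda>y. \<integral>\<^sup>+x. f (\<lambda>j\<in>insert i J. c * (x(i := y)) j) \<partial>?L J) \<in> borel_measurable lborel"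
      by (intro J.borel_measurable_nn_integral) (simp add: case_prod_beta)
  qed
  also have "(\<integral>\<^sup>+y. \<integral>\<^sup>+x. f (\<lambda>j\<in>insert i J. c * (x(i := y)) j) \<partial>?L J \<partial>lborel)
    = (\<integral>\<^sup>+x. f (\<lambda>j\<in>insert i J. c * x j) \<partial>?L (insert i J))"
    using insert by (intro lborel_prod.product_nn_integral_insert_rev[symmetric] m2) auto
  also have "ennreal c * (ennreal (c ^ card J) * (\<integral>\<^sup>+x. f (\<lambda>j\<in>insert i J. c * x j) \<partial>?L (insert i J)))
    = ennreal (c ^ card (insert i J)) * (\<integral>\<^sup>+x. f (\<lambda>j\<in>insert i J. c * x j) \<partial>?L (insert i J))"
  proof -
    have "ennreal (c ^ card (insert i J)) = ennreal c * ennreal (c ^ card J)"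
      using insert.hyps c by (simp add: ennreal_mult)
    then show ?thesis by (simp only: mult.assoc)
  qed
  finally show ?case .
qed

lemma nn_integral_lebN_scale:
  assumes "c > 0" "f \<in> borel_measurable (lebN n)"
  shows "(\<integral>\<^sup>+x. f x \<partial>lebN n) = ennreal (c ^ n) * (\<integral>\<^sup>+x. f (\<lambda>i\<in>{..<n}. c * x i) \<partial>lebN n)"
  using nn_integral_PiM_lborel_scale[of "{..<n}" c f] assms by (simp add: lebN_def)

text \<open>What is used of this volume is that it is positive and finite, hence can be
  cancelled.\<close>

lemma emeasure_unit_ball_lebN:
  "emeasure (lebN n) {x \<in> space (lebN n). Nsq n x \<le> 1} = ennreal (unit_ball_vol (real n))"
proof -
  have "{x \<in> space (lebN n). Nsq n x \<le> 1} = {f. sqrt (\<Sum>i<n. (f i)\<^sup>2) \<le> 1} \<inter> space (PiM {..<n} (\<lambda>_. lborel))"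
    by (auto simp: Nsq_def lebN_def)
  then show ?thesis
    using emeasure_cball_aux[of "{..<n}" 1] by (simp add: lebN_def)
qed

lemma Nsq_nonneg [simp]: "0 \<le> Nsq n x"
  by (simp add: Nsq_def sum_nonneg)

lemma Nsq_scale: "Nsq n (\<lambda>i\<in>{..<n}. c * x i) = c\<^sup>2 * Nsq n x"
  by (simp add: Nsq_def power_mult_distrib sum_distrib_left)

text \<open>Scaling by sqrt t carries the unit ball to the ball of squared radius t and leaves F
  unchanged; for t <= 0 that ball is a null set.\<close>

lemma nn_integral_ball_homogeneous:
  assumes d: "d \<ge> 1" and [measurable]: "F \<in> borel_measurable (lebN d)"
    and hom: "\<And>c x. c > 0 \<Longrightarrow> F (\<lambda>i\<in>{..<d}. c * x i) = F x"
  shows "(\<integral>\<^sup>+x. F x * indicator {..t} (Nsq d x) \<partial>lebN d) =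
    (if t > 0 then ennreal (sqrt t ^ d) else 0) * (\<integral>\<^sup>+x. F x * indicator {..1} (Nsq d x) \<partial>lebN d)"
proof (cases "t > 0")
  case True
  have "(\<integral>\<^sup>+x. F x * indicator {..t} (Nsq d x) \<partial>lebN d) =
    ennreal (sqrt t ^ d) * (\<integral>\<^sup>+x. F (\<lambda>i\<in>{..<d}. sqrt t * x i) * indicator {..t} (Nsq d (\<lambda>i\<in>{..<d}. sqrt t * x i)) \<partial>lebN d)"
    using True by (intro nn_integral_lebN_scale) auto
  also have "(\<integral>\<^sup>+x. F (\<lambda>i\<in>{..<d}. sqrt t * x i) * indicator {..t} (Nsq d (\<lambda>i\<in>{..<d}. sqrt t * x i)) \<partial>lebN d)
    = (\<integral>\<^sup>+x. F x * indicator {..1} (Nsq d x) \<partial>lebN d)"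
    using True unfolding Nsq_scale
    by (intro nn_integral_cong) (simp add: hom indicator_def)
  finally show ?thesis using True by simp
next
  case False
  \<comment> \<open>The origin, which is the whole ball for t = 0, lies in the null hyperplane where
    coordinate 0 vanishes; \<open>d \<ge> 1\<close> provides that coordinate.\<close>
  have "AE x in lebN d. x 0 \<noteq> 0"
  proof -
    interpret fin: finite_product_sigma_finite "\<lambda>_::nat. lborel :: real measure" "{..<d}" by unfold_locales simp
    have "emeasure (lebN d) (PiE {..<d} (\<lambda>i. if i = 0 then {0} else UNIV)) = (\<Prod>i<d. emeasure lborel (if i = 0 then {0} else UNIV :: real set))"
      unfolding lebN_def by (rule fin.measure_times) auto
    also have "\<dots> = 0" using d by (intro prod_zero) (auto intro!: bexI[of _ 0])
    finally have "PiE {..<d} (\<lambda>i. if i = 0 then {0} else UNIV) \<in> null_sets (lebN d)"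
      by (auto simp: null_sets_def lebN_def intro!: sets_PiM_I_finite)
    then show ?thesis
      by (rule AE_I') (use d in \<open>auto simp: PiE_iff extensional_def\<close>)
  qed
  then have "AE x in lebN d. F x * indicator {..t} (Nsq d x) = 0"
  proof eventually_elim
    case (elim x)
    have "0 < (x 0)\<^sup>2" using elim by simp
    also have "(x 0)\<^sup>2 \<le> Nsq d x"
      unfolding Nsq_def using d by (intro member_le_sum) auto
    finally show ?case using False by simp
  qed
  then have "(\<integral>\<^sup>+x. F x * indicator {..t} (Nsq d x) \<partial>lebN d) = (\<integral>\<^sup>+x. 0 \<partial>lebN d)"
    by (rule nn_integral_cong_AE)
  then show ?thesis using False by simp
qed

text \<open>Both sides, as functions of the radial factor, are integrals against measures on the line
  that agree on all half-lines by scaling.\<close>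

lemma nn_integral_polar:
  assumes d: "d \<ge> 1" and [measurable]: "F \<in> borel_measurable (lebN d)" "k \<in> borel_measurable borel"
    and hom: "\<And>c x. c > 0 \<Longrightarrow> F (\<lambda>i\<in>{..<d}. c * x i) = F x"
    and bd: "\<And>x. F x \<le> ennreal C"
  shows "(\<integral>\<^sup>+x. F x * indicator {..1} (Nsq d x) \<partial>lebN d) * (\<integral>\<^sup>+x. k (Nsq d x) \<partial>lebN d)
    = ennreal (unit_ball_vol (real d)) * (\<integral>\<^sup>+x. F x * k (Nsq d x) \<partial>lebN d)"
proof -
  \<comment> \<open>\<open>\<nu> G\<close> is the image under the squared radius of Lebesgue measure
    weighted by G, and \<open>I G\<close> is the mass it gives to the unit ball.\<close>
  define \<nu> where "\<nu> G = distr (density (lebN d) G) borel (Nsq d)" for G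
  define I where "I G = (\<integral>\<^sup>+x. G x * indicator {..1} (Nsq d x) \<partial>lebN d)" for G
  have I1: "I (\<lambda>_. 1) = ennreal (unit_ball_vol (real d))"
  proof -
    have "I (\<lambda>_. 1) = (\<integral>\<^sup>+x. indicator {x \<in> space (lebN d). Nsq d x \<le> 1} x \<partial>lebN d)"
      unfolding I_def by (intro nn_integral_cong) (auto simp: indicator_def)
    also have "\<dots> = emeasure (lebN d) {x \<in> space (lebN d). Nsq d x \<le> 1}"
      by (rule nn_integral_indicator) measurable
    finally show ?thesis unfolding emeasure_unit_ball_lebN .
  qed
  \<comment> \<open>Here the bound on F serves: uniqueness of measures requires finite mass on an
    exhausting sequence of half-lines.\<close>
  have "I F \<le> (\<integral>\<^sup>+x. ennreal C * indicator {..1} (Nsq d x) \<partial>lebN d)"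
    unfolding I_def by (intro nn_integral_mono mult_right_mono bd) auto
  also have "\<dots> = ennreal C * I (\<lambda>_. 1)"
    unfolding I_def by (simp add: nn_integral_cmult)
  also have "\<dots> < \<infinity>" by (simp add: I1 ennreal_mult_less_top)
  finally have IF: "I F \<noteq> \<infinity>" by simp
  have em: "emeasure (\<nu> G) {..t} = (if t > 0 then ennreal (sqrt t ^ d) else 0) * I G"
    if [measurable]: "G \<in> borel_measurable (lebN d)" and "\<And>c x. c > 0 \<Longrightarrow> G (\<lambda>i\<in>{..<d}. c * x i) = G x" for G t
  proof -
    have "emeasure (\<nu> G) {..t} = emeasure (density (lebN d) G) (Nsq d -` {..t} \<inter> space (lebN d))"
      unfolding \<nu>_def by (subst emeasure_distr) auto
    also have "\<dots> = (\<integral>\<^sup>+x. G x * indicator (Nsq d -` {..t} \<inter> space (lebN d)) x \<partial>lebN d)"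
      by (rule emeasure_density) measurable
    also have "\<dots> = (\<integral>\<^sup>+x. G x * indicator {..t} (Nsq d x) \<partial>lebN d)"
      by (intro nn_integral_cong) (auto simp: indicator_def)
    finally show ?thesis
      using nn_integral_ball_homogeneous[OF d that, of t] by (simp add: I_def)
  qed
  \<comment> \<open>Both measures are proportional on half-lines; the proportion is cross-multiplied
    to avoid division of extended reals.\<close>
  have "scale_measure (I F) (\<nu> (\<lambda>_. 1)) = scale_measure (I (\<lambda>_. 1)) (\<nu> F)"
  proof (rule measure_eqI_generator_eq[where E="range (\<lambda>t. {..t::real})" and \<Omega>=UNIV and A="\<lambda>i. {..real i}"])
    show "Int_stable (range (\<lambda>t. {..t::real}))"
      by (auto simp: Int_stable_def)
    show "sets (scale_measure (I F) (\<nu> (\<lambda>_. 1))) = sigma_sets UNIV (range (\<lambda>t. {..t::real}))"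
      "sets (scale_measure (I (\<lambda>_. 1)) (\<nu> F)) = sigma_sets UNIV (range (\<lambda>t. {..t::real}))"
      by (auto simp: \<nu>_def borel_eq_atMost)
    show "(\<Union>i. {..real i}) = UNIV"
      by (auto simp: real_arch_simple)
    show "emeasure (scale_measure (I F) (\<nu> (\<lambda>_. 1))) {..real i} \<noteq> \<infinity>" for i
      using IF by (simp add: em I1 ennreal_mult_eq_top_iff)
    show "emeasure (scale_measure (I F) (\<nu> (\<lambda>_. 1))) X = emeasure (scale_measure (I (\<lambda>_. 1)) (\<nu> F)) X"
      if "X \<in> range (\<lambda>t. {..t::real})" for X
      using that by (auto simp: em hom mult_ac)
  qed auto
  then have "(\<integral>\<^sup>+t. k t \<partial>scale_measure (I F) (\<nu> (\<lambda>_. 1))) = (\<integral>\<^sup>+t. k t \<partial>scale_measure (I (\<lambda>_. 1)) (\<nu> F))"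
    by simp
  then have "I F * (\<integral>\<^sup>+t. k t \<partial>\<nu> (\<lambda>_. 1)) = I (\<lambda>_. 1) * (\<integral>\<^sup>+t. k t \<partial>\<nu> F)"
    by (subst (asm) (1 2) nn_integral_scale_measure) (auto simp: \<nu>_def)
  moreover have "(\<integral>\<^sup>+t. k t \<partial>\<nu> G) = (\<integral>\<^sup>+x. G x * k (Nsq d x) \<partial>lebN d)"
    if [measurable]: "G \<in> borel_measurable (lebN d)" for G
    unfolding \<nu>_def by (subst nn_integral_distr) (auto simp: nn_integral_density)
  ultimately show ?thesis
    by (simp add: I1) (simp add: I_def)
qed

section \<open>Both ensembles on one Gaussian space\<close>

lemma unit_ball_vol_nonzero [simp]: "unit_ball_vol (real d) \<noteq> 0"
  using unit_ball_vol_pos[of "real d", OF of_nat_0_le_iff] by linarith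

lemma Nsq_restrict [simp]: "Nsq d (restrict x {..<d}) = Nsq d x"
  by (simp add: Nsq_def)

text \<open>Two uses of the polar formula, with g the Gaussian density as a function of the squared
  radius: for k = g it turns ball averages of F into Gaussian expectations, for k = g h it then
  gives independence of direction and radius.\<close>

lemma gauss_radial_indep:
  assumes d: "d \<ge> 1" and [measurable]: "F \<in> borel_measurable (lebN d)" "h \<in> borel_measurable borel"
    and hom: "\<And>c x. c > 0 \<Longrightarrow> F (\<lambda>i\<in>{..<d}. c * x i) = F x"
    and bd: "\<And>x. F x \<le> ennreal C"
  shows "(\<integral>\<^sup>+x. F x * indicator {..1} (Nsq d x) \<partial>lebN d) = ennreal (unit_ball_vol (real d)) * (\<integral>\<^sup>+x. F x \<partial>gaussN d)"
    and "(\<integral>\<^sup>+x. F x * h (Nsq d x) \<partial>gaussN d) = (\<integral>\<^sup>+x. F x \<partial>gaussN d) * (\<integral>\<^sup>+x. h (Nsq d x) \<partial>gaussN d)"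
proof -
  define g where "g t = ennreal ((1 / sqrt (2 * pi)) ^ d * exp (- t / 2))" for t
  have [measurable]: "g \<in> borel_measurable borel" unfolding g_def by measurable
  have gN: "(\<integral>\<^sup>+x. G x \<partial>gaussN d) = (\<integral>\<^sup>+x. g (Nsq d x) * G x \<partial>lebN d)" if [measurable]: "G \<in> borel_measurable (lebN d)" for G
    unfolding gaussN_eq_density g_def by (rule nn_integral_density) measurable
  let ?V = "ennreal (unit_ball_vol (real d))"
  have V: "?V \<noteq> 0" "?V \<noteq> \<infinity>" by auto
  interpret prob_space "gaussN d" by (rule prob_space_gaussN)
  have "(\<integral>\<^sup>+x. g (Nsq d x) \<partial>lebN d) = 1"
    using gN[of "\<lambda>_. 1"] emeasure_space_1 by simp
  with nn_integral_polar[OF d assms(2) \<open>g \<in> _\<close> hom bd]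
  show 1: "(\<integral>\<^sup>+x. F x * indicator {..1} (Nsq d x) \<partial>lebN d) = ?V * (\<integral>\<^sup>+x. F x \<partial>gaussN d)"
    by (simp add: gN mult.commute)
  have "?V * (\<integral>\<^sup>+x. F x \<partial>gaussN d) * (\<integral>\<^sup>+x. h (Nsq d x) \<partial>gaussN d) = ?V * (\<integral>\<^sup>+x. F x * h (Nsq d x) \<partial>gaussN d)"
    using nn_integral_polar[OF d assms(2) _ hom bd, of "\<lambda>t. g t * h t"]
    unfolding 1 by (simp add: gN mult_ac)
  then show "(\<integral>\<^sup>+x. F x * h (Nsq d x) \<partial>gaussN d) = (\<integral>\<^sup>+x. F x \<partial>gaussN d) * (\<integral>\<^sup>+x. h (Nsq d x) \<partial>gaussN d)"
    using V by (simp add: mult.assoc ennreal_mult_cancel_left)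
qed

text \<open>The indicator of a set of directions is homogeneous of degree 0, so its average over the
  ball equals its Gaussian expectation.\<close>

lemma sphere_unif_eq_gauss:
  assumes d: "d \<ge> 1"
  shows "sphere_unif d = distr (gaussN d) (lebN d) (\<lambda>x. \<lambda>i\<in>{..<d}. x i / sqrt (Nsq d x))"
    (is "_ = distr _ _ ?dir")
proof (rule measure_eqI)
  fix A assume "A \<in> sets (sphere_unif d)"
  then have [measurable]: "A \<in> sets (lebN d)" by (simp add: sphere_unif_def)
  let ?B = "{x \<in> space (lebN d). Nsq d x \<le> 1}"
  let ?V = "ennreal (unit_ball_vol (real d))"
  have [measurable]: "?dir \<in> measurable (lebN d) (lebN d)"
    by (rule measurable_into_lebN) auto
  have B[measurable]: "?B \<in> sets (lebN d)" by measurable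
  define F :: "(nat \<Rightarrow> real) \<Rightarrow> ennreal" where "F x = indicator A (?dir x)" for x
  have [measurable]: "F \<in> borel_measurable (lebN d)" unfolding F_def by measurable
  \<comment> \<open>This includes the origin: division by 0 makes its direction the zero vector,
    before and after scaling.\<close>
  have hom: "F (\<lambda>i\<in>{..<d}. c * x i) = F x" if "c > 0" for c x
  proof -
    have "?dir (\<lambda>i\<in>{..<d}. c * x i) = ?dir x"
      unfolding Nsq_scale using that by (auto simp: fun_eq_iff real_sqrt_mult)
    then show ?thesis by (simp only: F_def)
  qed
  have bd: "F x \<le> ennreal 1" for x by (auto simp: F_def indicator_def)
  have "emeasure (sphere_unif d) A = emeasure (uniform_measure (lebN d) ?B) (?dir -` A \<inter> space (lebN d))"
    unfolding sphere_unif_def by (subst emeasure_distr) auto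
  also have "\<dots> = emeasure (lebN d) (?B \<inter> (?dir -` A \<inter> space (lebN d))) / emeasure (lebN d) ?B"
    by (rule emeasure_uniform_measure) measurable
  also have "emeasure (lebN d) (?B \<inter> (?dir -` A \<inter> space (lebN d))) = (\<integral>\<^sup>+x. indicator (?B \<inter> (?dir -` A \<inter> space (lebN d))) x \<partial>lebN d)"
    by (rule nn_integral_indicator[symmetric]) measurable
  also have "\<dots> = (\<integral>\<^sup>+x. F x * indicator {..1} (Nsq d x) \<partial>lebN d)"
    by (intro nn_integral_cong) (auto simp: F_def indicator_def)
  also have "\<dots> = ?V * (\<integral>\<^sup>+x. F x \<partial>gaussN d)"
    by (rule gauss_radial_indep(1)[OF d _ _ hom bd, where h="\<lambda>_. 0"]) auto
  also have "\<dots> / emeasure (lebN d) ?B = (\<integral>\<^sup>+x. F x \<partial>gaussN d)"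
    unfolding emeasure_unit_ball_lebN
    by (subst mult.commute, rule ennreal_mult_divide_eq) auto
  also have "\<dots> = (\<integral>\<^sup>+x. indicator A x \<partial>distr (gaussN d) (lebN d) ?dir)"
    unfolding F_def by (rule nn_integral_distr[symmetric]) measurable
  also have "\<dots> = emeasure (distr (gaussN d) (lebN d) ?dir) A"
    by (rule nn_integral_indicator) simp
  finally show "emeasure (sphere_unif d) A = emeasure (distr (gaussN d) (lebN d) ?dir) A" .
qed (simp add: sphere_unif_def)

section \<open>Marginals of the Gaussian vector and the coupled fields\<close>

lemma distr_gaussN_restrict:
  "d \<le> n \<Longrightarrow> distr (gaussN n) (gaussN d) (\<lambda>x. restrict x {..<d}) = gaussN d"
  unfolding gaussN_def
  by (rule std_gauss_prod.distr_restrict[symmetric]) auto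

lemma measurable_restrict_gaussN [measurable]:
  "d \<le> n \<Longrightarrow> (\<lambda>x. restrict x {..<d}) \<in> measurable (gaussN n) (gaussN d)"
  unfolding gaussN_def by (rule measurable_restrict_subset) auto

text \<open>The coupling lives on \<open>gaussN n\<close>, the polar argument on
  \<open>gaussN (n - 1)\<close>; this passes between them for functions that read only the first
  coordinates.\<close>

lemma nn_integral_gaussN_restrict:
  assumes "d \<le> n" and [measurable]: "f \<in> borel_measurable (lebN d)"
    and loc: "\<And>x. f (restrict x {..<d}) = f x"
  shows "(\<integral>\<^sup>+x. f x \<partial>gaussN n) = (\<integral>\<^sup>+x. f x \<partial>gaussN d)"
proof -
  have "(\<integral>\<^sup>+x. f x \<partial>gaussN d) = (\<integral>\<^sup>+x. f x \<partial>distr (gaussN n) (gaussN d) (\<lambda>x. restrict x {..<d}))"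
    using distr_gaussN_restrict[OF assms(1)] by simp
  also have "\<dots> = (\<integral>\<^sup>+x. f (restrict x {..<d}) \<partial>gaussN n)"
    using assms(1) by (intro nn_integral_distr[where T="\<lambda>x. restrict x {..<d}" and f=f]) measurable
  finally show ?thesis by (simp add: loc)
qed

lemma nn_integral_gaussN_component:
  assumes "j < n" and [measurable]: "f \<in> borel_measurable borel"
  shows "(\<integral>\<^sup>+x. f (x j) \<partial>gaussN n) = (\<integral>\<^sup>+y. f y \<partial>std_gauss)"
proof -
  have "distr (gaussN n) std_gauss (\<lambda>x. x j) = std_gauss"
    unfolding gaussN_def using assms(1)
    by (intro distr_PiM_component std_gauss.prob_space_axioms) auto
  then have "(\<integral>\<^sup>+y. f y \<partial>std_gauss) = (\<integral>\<^sup>+y. f y \<partial>distr (gaussN n) std_gauss (\<lambda>x. x j))"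
    by simp
  also have "\<dots> = (\<integral>\<^sup>+x. f (x j) \<partial>gaussN n)"
    using assms(1) by (intro nn_integral_distr[where T="\<lambda>x. x j" and f=f]) (auto simp: gaussN_def measurable_cong_sets[OF sets_std_gauss refl] intro!: measurable_component_singleton)
  finally show ?thesis by simp
qed

text \<open>The microcanonical field with m and sigma removed, as a function of Gaussian Helmert
  coordinates x: the first n - 1 of them, rescaled to length sqrt n.\<close>

definition mc_field :: "nat \<Rightarrow> (nat \<Rightarrow> real) \<Rightarrow> nat \<Rightarrow> real" where
  "mc_field n x j = sqrt (real n) * (hinv (n - 1) x j / sqrt (Nsq (n - 1) x))"

text \<open>The inverse of \<open>hmap\<close>. It shares the coordinates below n - 1 with
  \<open>mc_field\<close>, and this sharing is the coupling.\<close>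

definition gc_field :: "nat \<Rightarrow> (nat \<Rightarrow> real) \<Rightarrow> nat \<Rightarrow> real" where
  "gc_field n x j = hinv (n - 1) x j + x (n - 1) / sqrt (real n)"

lemma measurable_hinv: "d \<le> n \<Longrightarrow> (\<lambda>x. hinv d x j) \<in> borel_measurable (lebN n)"
  unfolding hinv_def by measurable

lemma measurable_mc_field [measurable]: "(\<lambda>x. mc_field n x j) \<in> borel_measurable (lebN n)"
proof -
  have [measurable]: "(\<lambda>x. hinv (n - 1) x j) \<in> borel_measurable (lebN n)" "Nsq (n - 1) \<in> borel_measurable (lebN n)"
    by (rule measurable_hinv measurable_Nsq_le, simp)+
  show ?thesis unfolding mc_field_def by measurable
qed

lemma measurable_gc_field [measurable]: "n \<ge> 1 \<Longrightarrow> (\<lambda>x. gc_field n x j) \<in> borel_measurable (lebN n)"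
proof -
  assume "n \<ge> 1"
  then have [measurable]: "(\<lambda>x. hinv (n - 1) x j) \<in> borel_measurable (lebN n)" "(\<lambda>x. x (n - 1)) \<in> borel_measurable (lebN n)"
    by (auto intro: measurable_hinv measurable_component_lebN)
  show ?thesis unfolding gc_field_def by measurable
qed

lemma mc_measure_eq_gauss:
  assumes n: "n \<ge> 2" and s: "s \<ge> 0" "s\<^sup>2 = \<rho> - m\<^sup>2"
  shows "mc_measure n m \<rho> = distr (gaussN n) (lebN n) (\<lambda>x. \<lambda>j\<in>{..<n}. m + s * mc_field n x j)"
proof -
  let ?d = "n - 1"
  let ?dir = "\<lambda>x. \<lambda>i\<in>{..<?d}. x i / sqrt (Nsq ?d x)"
  let ?emb = "\<lambda>y. \<lambda>j\<in>{..<n}. m + sqrt (real n * (\<rho> - m\<^sup>2)) * (\<Sum>k<?d. y k * helmert k j)"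
  have d: "?d \<ge> 1" "?d \<le> n" using n by auto
  have [measurable]: "?dir \<in> measurable (lebN ?d) (lebN ?d)"
    by (rule measurable_into_lebN) auto
  have [measurable]: "?emb \<in> measurable (lebN ?d) (lebN n)"
    by (rule measurable_into_lebN) auto
  have "mc_measure n m \<rho> = distr (distr (gaussN ?d) (lebN ?d) ?dir) (lebN n) ?emb"
    unfolding mc_measure_def sphere_unif_eq_gauss[OF d(1)] ..
  also have "\<dots> = distr (gaussN ?d) (lebN n) (?emb \<circ> ?dir)"
    by (rule distr_distr) measurable
  \<comment> \<open>The last Gaussian coordinate is adjoined so that both ensembles become images of
    the same \<open>gaussN n\<close>.\<close>
  also have "\<dots> = distr (distr (gaussN n) (gaussN ?d) (\<lambda>x. restrict x {..<?d})) (lebN n) (?emb \<circ> ?dir)"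
    unfolding distr_gaussN_restrict[OF d(2)] ..
  also have "\<dots> = distr (gaussN n) (lebN n) ((?emb \<circ> ?dir) \<circ> (\<lambda>x. restrict x {..<?d}))"
    using d(2) by (intro distr_distr) measurable
  also have "(?emb \<circ> ?dir) \<circ> (\<lambda>x. restrict x {..<?d}) = (\<lambda>x. \<lambda>j\<in>{..<n}. m + s * mc_field n x j)"
  proof (intro ext)
    fix x j
    have r: "sqrt (real n * (\<rho> - m\<^sup>2)) = sqrt (real n) * s"
      using s by (simp add: real_sqrt_mult flip: s(2))
    show "((?emb \<circ> ?dir) \<circ> (\<lambda>x. restrict x {..<?d})) x j = (\<lambda>j\<in>{..<n}. m + s * mc_field n x j) j"
      unfolding r by (auto simp: mc_field_def hinv_def sum_divide_distrib mult_ac)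
  qed
  finally show ?thesis .
qed

lemma hinv_hmap: "hinv (n - 1) (hmap n z) j = hinv (n - 1) (\<lambda>k. hcoef k z) j"
  unfolding hinv_def by (intro sum.cong) (auto simp: hmap_def)

lemma gc_field_hmap: "n \<ge> 1 \<Longrightarrow> j < n \<Longrightarrow> gc_field n (hmap n z) j = z j"
  unfolding gc_field_def hinv_hmap using hmap_inverse[of n j z] by (simp add: hmap_def)

text \<open>Precompose with \<open>hmap\<close>, which preserves the Gaussian measure and is undone
  by \<open>gc_field\<close>.\<close>

lemma distr_gaussN_gc_field:
  assumes n: "n \<ge> 1"
  shows "distr (gaussN n) (lebN n) (\<lambda>x. \<lambda>j\<in>{..<n}. m + s * gc_field n x j)
    = distr (gaussN n) (lebN n) (\<lambda>x. \<lambda>j\<in>{..<n}. m + s * x j)"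
proof -
  let ?g = "\<lambda>x. \<lambda>j\<in>{..<n}. m + s * gc_field n x j"
  have [measurable]: "?g \<in> measurable (lebN n) (lebN n)"
    using n by (intro measurable_into_lebN) auto
  have "distr (gaussN n) (lebN n) ?g = distr (distr (gaussN n) (lebN n) (hmap n)) (lebN n) ?g"
    unfolding distr_gaussN_hmap[OF n] ..
  also have "\<dots> = distr (gaussN n) (lebN n) (?g \<circ> hmap n)"
    by (rule distr_distr) measurable
  also have "?g \<circ> hmap n = (\<lambda>x. \<lambda>j\<in>{..<n}. m + s * x j)"
    using n by (auto simp: fun_eq_iff gc_field_hmap)
  finally show ?thesis .
qed

lemma nn_integral_gc_field:
  assumes j: "j < n" and [measurable]: "f \<in> borel_measurable borel"
  shows "(\<integral>\<^sup>+x. f (gc_field n x j) \<partial>gaussN n) = (\<integral>\<^sup>+y. f y \<partial>std_gauss)"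
proof -
  have n: "n \<ge> 1" using j by simp
  have "(\<integral>\<^sup>+x. f (gc_field n x j) \<partial>gaussN n) = (\<integral>\<^sup>+x. f (gc_field n x j) \<partial>distr (gaussN n) (lebN n) (hmap n))"
    unfolding distr_gaussN_hmap[OF n] ..
  also have "\<dots> = (\<integral>\<^sup>+x. f (gc_field n (hmap n x) j) \<partial>gaussN n)"
    using n by (intro nn_integral_distr) measurable
  also have "\<dots> = (\<integral>\<^sup>+y. f y \<partial>std_gauss)"
    using n j by (simp add: gc_field_hmap nn_integral_gaussN_component)
  finally show ?thesis .
qed

section \<open>Moment bounds\<close>

text \<open>The moment of order 2p of a standard Gaussian, that is (2p - 1)!!.\<close>

definition gmom :: "nat \<Rightarrow> real" where
  "gmom p = fact (2 * p) / (2 ^ p * fact p)"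

lemma gmom_nonneg [simp]: "0 \<le> gmom p"
  by (simp add: gmom_def)

lemma gmom_1: "gmom 1 = 1" and gmom_2: "gmom 2 = 3"
  by (simp_all add: gmom_def fact_numeral)

lemma nn_integral_std_gauss_moment: "(\<integral>\<^sup>+y. ennreal (y ^ (2 * p)) \<partial>std_gauss) = ennreal (gmom p)"
proof -
  have "(\<integral>\<^sup>+y. ennreal (y ^ (2 * p)) \<partial>std_gauss) = (\<integral>\<^sup>+y. ennreal (std_normal_density y * y ^ (2 * p)) \<partial>lborel)"
    by (subst nn_integral_std_gauss) (auto simp: ennreal_mult')
  also have "\<dots> = ennreal (gmom p)"
    unfolding gmom_def integral_std_normal_moment_even[symmetric]
    by (rule nn_integral_eq_integral) (auto intro: integrable_std_normal_moment)
  finally show ?thesis .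
qed

lemma nn_integral_Nsq: "(\<integral>\<^sup>+x. ennreal (Nsq d x) \<partial>gaussN d) = ennreal (real d)"
proof -
  have "(\<integral>\<^sup>+x. ennreal (Nsq d x) \<partial>gaussN d) = (\<integral>\<^sup>+x. (\<Sum>i<d. ennreal ((x i) ^ (2 * 1))) \<partial>gaussN d)"
    by (intro nn_integral_cong) (simp add: Nsq_def sum_ennreal)
  also have "\<dots> = (\<Sum>i<d. \<integral>\<^sup>+x. ennreal ((x i) ^ (2 * 1)) \<partial>gaussN d)"
    by (rule nn_integral_sum) auto
  also have "\<dots> = (\<Sum>i<d. 1)"
  proof (rule sum.cong)
    fix i assume "i \<in> {..<d}"
    then show "(\<integral>\<^sup>+x. ennreal ((x i) ^ (2 * 1)) \<partial>gaussN d) = 1"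
      using nn_integral_gaussN_component[of i d "\<lambda>y. ennreal (y ^ (2 * 1))"]
      unfolding nn_integral_std_gauss_moment gmom_1 by simp
  qed simp
  finally show ?thesis by (simp add: ennreal_of_nat_eq_real_of_nat)
qed

text \<open>Second moment of a chi-square law: squaring A + y^2 for one new coordinate y adds 2 d +
  3, as E y^2 = 1 and E y^4 = 3.\<close>

lemma nn_integral_Nsq_squared: "(\<integral>\<^sup>+x. ennreal ((Nsq d x)\<^sup>2) \<partial>gaussN d) = ennreal (real d ^ 2 + 2 * real d)"
proof (induction d)
  case 0
  then show ?case by (simp add: Nsq_def)
next
  case (Suc d)
  interpret prob_space "gaussN d" by (rule prob_space_gaussN)
  have N: "Nsq (Suc d) (x(d := y)) = Nsq d x + y\<^sup>2" for x y
    by (simp add: Nsq_def)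
  have y2: "(\<integral>\<^sup>+y. ennreal (y\<^sup>2) \<partial>std_gauss) = 1" and y4: "(\<integral>\<^sup>+y. ennreal (y ^ 4) \<partial>std_gauss) = 3"
    using nn_integral_std_gauss_moment[of 1] nn_integral_std_gauss_moment[of 2] unfolding gmom_1 gmom_2
    by simp_all
  have "(\<integral>\<^sup>+x. ennreal ((Nsq (Suc d) x)\<^sup>2) \<partial>gaussN (Suc d))
    = (\<integral>\<^sup>+x. \<integral>\<^sup>+y. ennreal ((Nsq d x + y\<^sup>2)\<^sup>2) \<partial>std_gauss \<partial>gaussN d)"
    by (subst nn_integral_gaussN_Suc(1)) (auto simp: N)
  also have "\<dots> = (\<integral>\<^sup>+x. \<integral>\<^sup>+y. ennreal ((Nsq d x)\<^sup>2) + (ennreal (2 * Nsq d x) * ennreal (y\<^sup>2) + ennreal (y ^ 4)) \<partial>std_gauss \<partial>gaussN d)"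
    by (intro nn_integral_cong)
       (simp add: ennreal_mult'[symmetric] ennreal_plus[symmetric] power2_sum algebra_simps del: ennreal_plus)
  also have "\<dots> = (\<integral>\<^sup>+x. ennreal ((Nsq d x)\<^sup>2) + (ennreal 2 * ennreal (Nsq d x) + 3) \<partial>gaussN d)"
  proof (rule nn_integral_cong)
    have *: "(\<integral>\<^sup>+y. ennreal (t\<^sup>2) + (ennreal (2 * t) * ennreal (y\<^sup>2) + ennreal (y ^ 4)) \<partial>std_gauss)
      = ennreal (t\<^sup>2) + (ennreal 2 * ennreal t + 3)" if t: "t \<ge> 0" for t :: real
    proof -
      have "(\<integral>\<^sup>+y. ennreal (t\<^sup>2) + (ennreal (2 * t) * ennreal (y\<^sup>2) + ennreal (y ^ 4)) \<partial>std_gauss)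
        = ennreal (t\<^sup>2) + (\<integral>\<^sup>+y. ennreal (2 * t) * ennreal (y\<^sup>2) + ennreal (y ^ 4) \<partial>std_gauss)"
        using std_gauss.emeasure_space_1 by (subst nn_integral_add) auto
      also have "(\<integral>\<^sup>+y. ennreal (2 * t) * ennreal (y\<^sup>2) + ennreal (y ^ 4) \<partial>std_gauss)
        = (\<integral>\<^sup>+y. ennreal (2 * t) * ennreal (y\<^sup>2) \<partial>std_gauss) + 3"
        by (subst nn_integral_add) (auto simp: y4)
      also have "(\<integral>\<^sup>+y. ennreal (2 * t) * ennreal (y\<^sup>2) \<partial>std_gauss) = ennreal (2 * t)"
        by (subst nn_integral_cmult) (auto simp: y2)
      finally show ?thesis by (simp add: ennreal_mult')
    qed
    show "(\<integral>\<^sup>+y. ennreal ((Nsq d x)\<^sup>2) + (ennreal (2 * Nsq d x) * ennreal (y\<^sup>2) + ennreal (y ^ 4)) \<partial>std_gauss)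
      = ennreal ((Nsq d x)\<^sup>2) + (ennreal 2 * ennreal (Nsq d x) + 3)" for x
      by (rule *) simp
  qed
  also have "\<dots> = ennreal (real d ^ 2 + 2 * real d) + (2 * ennreal (real d) + 3)"
    using emeasure_space_1 by (simp add: nn_integral_add nn_integral_cmult Suc.IH nn_integral_Nsq)
  also have "\<dots> = ennreal (real (Suc d) ^ 2 + 2 * real (Suc d))"
    by (simp add: ennreal_plus[symmetric] ennreal_mult'[symmetric] ennreal_numeral[symmetric] power2_eq_square algebra_simps
        del: ennreal_plus ennreal_numeral)
  finally show ?case .
qed

text \<open>The deviation is measured from \<open>Suc d\<close>, the number of sites, instead of the
  mean d: the variance 2 d gains the squared bias 1.\<close>

lemma nn_integral_Nsq_variance:
  "(\<integral>\<^sup>+x. ennreal ((real (Suc d) - Nsq d x)\<^sup>2) \<partial>gaussN d) = ennreal (2 * real d + 1)"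
proof -
  interpret prob_space "gaussN d" by (rule prob_space_gaussN)
  \<comment> \<open>The expanded square with its negative term moved across, so that only
    nonnegative functions are integrated; the finite extra term is cancelled at the end.\<close>
  have eq: "ennreal ((real (Suc d) - t)\<^sup>2) + ennreal (2 * real (Suc d)) * ennreal t = ennreal (t\<^sup>2) + ennreal (real (Suc d) ^ 2)"
    if t: "t \<ge> 0" for t
  proof -
    have "ennreal ((real (Suc d) - t)\<^sup>2) + ennreal (2 * real (Suc d)) * ennreal t = ennreal ((real (Suc d) - t)\<^sup>2 + 2 * real (Suc d) * t)"
      using t by (subst ennreal_plus) (auto simp: ennreal_mult')
    also have "(real (Suc d) - t)\<^sup>2 + 2 * real (Suc d) * t = t\<^sup>2 + real (Suc d) ^ 2"
      by (simp only: power2_eq_square algebra_simps)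
    finally show ?thesis by simp
  qed
  have "(\<integral>\<^sup>+x. ennreal ((real (Suc d) - Nsq d x)\<^sup>2) \<partial>gaussN d) + ennreal (2 * real (Suc d)) * ennreal (real d)
    = (\<integral>\<^sup>+x. ennreal ((real (Suc d) - Nsq d x)\<^sup>2) + ennreal (2 * real (Suc d)) * ennreal (Nsq d x) \<partial>gaussN d)"
    by (subst nn_integral_add) (auto simp: nn_integral_cmult nn_integral_Nsq)
  also have "\<dots> = (\<integral>\<^sup>+x. ennreal ((Nsq d x)\<^sup>2) + ennreal (real (Suc d) ^ 2) \<partial>gaussN d)"
    by (intro nn_integral_cong eq) simp
  also have "\<dots> = ennreal (real d ^ 2 + 2 * real d) + ennreal (real (Suc d) ^ 2)"
    using emeasure_space_1 by (subst nn_integral_add) (auto simp: nn_integral_Nsq_squared)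
  also have "\<dots> = ennreal (2 * real d + 1) + ennreal (2 * real (Suc d)) * ennreal (real d)"
    by (simp add: ennreal_plus[symmetric] ennreal_mult'[symmetric] power2_eq_square algebra_simps del: ennreal_plus)
  finally have "ennreal (2 * real (Suc d)) * ennreal (real d) + (\<integral>\<^sup>+x. ennreal ((real (Suc d) - Nsq d x)\<^sup>2) \<partial>gaussN d)
    = ennreal (2 * real (Suc d)) * ennreal (real d) + ennreal (2 * real d + 1)"
    by (simp only: add.commute)
  then show ?thesis
    by (simp add: ennreal_add_left_cancel ennreal_mult_eq_top_iff)
qed

text \<open>Jensen's inequality for t^p at the mean d, the tangent line being supplied by
  Bernoulli's inequality.\<close>

lemma nn_integral_Nsq_power_ge:
  assumes d: "d \<ge> 1"
  shows "ennreal (real d ^ p) \<le> (\<integral>\<^sup>+x. ennreal (Nsq d x ^ p) \<partial>gaussN d)"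
proof -
  interpret prob_space "gaussN d" by (rule prob_space_gaussN)
  have bern: "real d ^ p + real p * real d ^ p / real d * t \<le> t ^ p + real p * real d ^ p" if t: "t \<ge> 0" for t
  proof -
    have "1 + real p * (t / real d - 1) \<le> (1 + (t / real d - 1)) ^ p"
      using d t by (intro Bernoulli_inequality) simp
    then have "real d ^ p * (1 + real p * (t / real d - 1)) \<le> real d ^ p * (t / real d) ^ p"
      by (intro mult_left_mono) auto
    then show ?thesis
      using d by (simp add: power_divide algebra_simps)
  qed
  define c b where "c = real p * real d ^ p" and "b = c / real d"
  have c: "c \<ge> 0" "b \<ge> 0" "b * real d = c"
    using d by (auto simp: c_def b_def)
  have "ennreal (real d ^ p) + ennreal c = ennreal (real d ^ p) + ennreal b * ennreal (real d)"
    using c by (simp flip: ennreal_mult')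
  also have "\<dots> = (\<integral>\<^sup>+x. ennreal (real d ^ p) + ennreal b * ennreal (Nsq d x) \<partial>gaussN d)"
    using emeasure_space_1 by (subst nn_integral_add, measurable, subst nn_integral_cmult, measurable) (simp add: nn_integral_Nsq)
  also have "\<dots> \<le> (\<integral>\<^sup>+x. ennreal (Nsq d x ^ p) + ennreal c \<partial>gaussN d)"
  proof (rule nn_integral_mono)
    fix x
    have "ennreal (real d ^ p) + ennreal b * ennreal (Nsq d x) = ennreal (real d ^ p + b * Nsq d x)"
      using c by (simp add: ennreal_mult)
    also have "\<dots> \<le> ennreal (Nsq d x ^ p + c)"
      using bern[OF Nsq_nonneg[of d x]] by (intro ennreal_leI) (simp add: b_def c_def)
    finally show "ennreal (real d ^ p) + ennreal b * ennreal (Nsq d x) \<le> ennreal (Nsq d x ^ p) + ennreal c"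
      using c by simp
  qed
  also have "\<dots> = (\<integral>\<^sup>+x. ennreal (Nsq d x ^ p) \<partial>gaussN d) + ennreal c"
    using emeasure_space_1 by (subst nn_integral_add) auto
  finally have "ennreal c + ennreal (real d ^ p) \<le> ennreal c + (\<integral>\<^sup>+x. ennreal (Nsq d x ^ p) \<partial>gaussN d)"
    by (simp only: add.commute)
  then show ?thesis
    by (subst (asm) ennreal_add_left_cancel_le) auto
qed

lemma power_even_add_le:
  fixes a b :: real
  shows "(a + b) ^ (2 * p) \<le> 4 ^ p * (a ^ (2 * p) + b ^ (2 * p))"
proof -
  have "(a + b)\<^sup>2 \<le> 4 * max (a\<^sup>2) (b\<^sup>2)"
  proof -
    have "(a + b)\<^sup>2 \<le> 2 * a\<^sup>2 + 2 * b\<^sup>2"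
      using zero_le_power2[of "a - b"] by (simp add: power2_eq_square algebra_simps)
    then show ?thesis by linarith
  qed
  then have "((a + b)\<^sup>2) ^ p \<le> (4 * max (a\<^sup>2) (b\<^sup>2)) ^ p"
    by (rule power_mono) simp
  also have "\<dots> = 4 ^ p * max (a\<^sup>2) (b\<^sup>2) ^ p"
    by (simp add: power_mult_distrib)
  also have "max (a\<^sup>2) (b\<^sup>2) ^ p \<le> (a\<^sup>2) ^ p + (b\<^sup>2) ^ p"
    by (cases "a\<^sup>2 \<le> b\<^sup>2") (auto simp: max_def)
  finally show ?thesis by (simp add: power_mult)
qed

text \<open>\<open>hinv\<close> is \<open>gc_field\<close> minus x (n - 1)/sqrt n. The first is a
  standard Gaussian and the second has variance 1/n <= 1, whence the factor 2.\<close>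

lemma hinv_moment:
  assumes n: "n \<ge> 2" and j: "j < n"
  shows "(\<integral>\<^sup>+x. ennreal (hinv (n - 1) x j ^ (2 * p)) \<partial>gaussN (n - 1)) \<le> ennreal (2 * 4 ^ p * gmom p)"
proof -
  have n1: "n \<ge> 1" "n - 1 < n" using n by auto
  have loc: "hinv (n - 1) (restrict x {..<n - 1}) j = hinv (n - 1) x j" for x
    by (simp add: hinv_def)
  have pt: "hinv (n - 1) x j ^ (2 * p) \<le> 4 ^ p * (gc_field n x j ^ (2 * p) + x (n - 1) ^ (2 * p))" for x
  proof -
    have "hinv (n - 1) x j ^ (2 * p) = (gc_field n x j + - (x (n - 1) / sqrt (real n))) ^ (2 * p)"
      by (simp add: gc_field_def)
    also have "\<dots> \<le> 4 ^ p * (gc_field n x j ^ (2 * p) + (- (x (n - 1) / sqrt (real n))) ^ (2 * p))"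
      by (rule power_even_add_le)
    also have "(- (x (n - 1) / sqrt (real n))) ^ (2 * p) \<le> x (n - 1) ^ (2 * p)"
    proof -
      have "(- (x (n - 1) / sqrt (real n))) ^ (2 * p) = x (n - 1) ^ (2 * p) / real n ^ p"
        using n by (simp add: power_mult power_divide)
      also have "\<dots> \<le> x (n - 1) ^ (2 * p) / 1"
        using n by (intro divide_left_mono) auto
      finally show ?thesis by simp
    qed
    finally show ?thesis by simp
  qed
  have "(\<integral>\<^sup>+x. ennreal (hinv (n - 1) x j ^ (2 * p)) \<partial>gaussN (n - 1)) = (\<integral>\<^sup>+x. ennreal (hinv (n - 1) x j ^ (2 * p)) \<partial>gaussN n)"
  proof (rule nn_integral_gaussN_restrict[symmetric])
    have [measurable]: "(\<lambda>x. hinv (n - 1) x j) \<in> borel_measurable (lebN (n - 1))"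
      by (rule measurable_hinv) simp
    show "(\<lambda>x. ennreal (hinv (n - 1) x j ^ (2 * p))) \<in> borel_measurable (lebN (n - 1))"
      by measurable
  qed (simp_all only: loc diff_le_self)
  also have "\<dots> \<le> (\<integral>\<^sup>+x. ennreal (4 ^ p) * (ennreal (gc_field n x j ^ (2 * p)) + ennreal (x (n - 1) ^ (2 * p))) \<partial>gaussN n)"
    using pt by (intro nn_integral_mono)
      (simp add: ennreal_plus[symmetric] ennreal_mult'[symmetric] ennreal_leI power_mult del: ennreal_plus)
  also have "\<dots> = ennreal (4 ^ p) * (ennreal (gmom p) + ennreal (gmom p))"
    using n1 j nn_integral_gc_field[of j n "\<lambda>y. ennreal (y ^ (2 * p))"] nn_integral_gaussN_component[of "n - 1" n "\<lambda>y. ennreal (y ^ (2 * p))"]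
    by (simp add: nn_integral_cmult nn_integral_add nn_integral_std_gauss_moment)
  also have "\<dots> = ennreal (2 * 4 ^ p * gmom p)"
    by (simp add: ennreal_plus[symmetric] ennreal_mult'[symmetric] del: ennreal_plus)
  finally show ?thesis .
qed

section \<open>Splitting the orthogonal component into direction and radius\<close>

lemma hinv_scale: "hinv d (\<lambda>i\<in>{..<d}. c * x i) j = c * hinv d x j"
  by (simp add: hinv_def sum_distrib_left mult.assoc)

lemma abs_helmert_le: "\<bar>helmert k j\<bar> \<le> 1"
proof -
  define a where "a = real (k + 1)"
  have a: "a \<ge> 1" by (simp add: a_def)
  have "a * a \<le> a * (a + 1)" using a by (intro mult_left_mono) auto
  then have sa: "a \<le> sqrt (a * (a + 1))"
    using a by (intro real_le_rsqrt) (simp add: power2_eq_square)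
  have "1 * 1 \<le> a * (a + 1)" using a by (intro mult_mono) auto
  with sa show ?thesis
    using a unfolding helmert_def Let_def a_def[symmetric] by (auto simp: divide_le_eq)
qed

text \<open>A crude bound with two uses: it bounds the direction, as the polar formula demands, and
  it makes \<open>hinv\<close> vanish where the radius is 0, so that dividing by the radius loses
  nothing.\<close>

lemma abs_hinv_le: "\<bar>hinv d x j\<bar> \<le> real d * sqrt (Nsq d x)"
proof -
  have "\<bar>hinv d x j\<bar> \<le> (\<Sum>k<d. \<bar>x k * helmert k j\<bar>)"
    unfolding hinv_def by (rule sum_abs)
  also have "\<dots> \<le> (\<Sum>k<d. sqrt (Nsq d x))"
  proof (rule sum_mono)
    fix k assume "k \<in> {..<d}"
    then have "(x k)\<^sup>2 \<le> Nsq d x" unfolding Nsq_def by (intro member_le_sum) auto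
    then have "\<bar>x k\<bar> \<le> sqrt (Nsq d x)" by (intro real_le_rsqrt) simp
    then have "\<bar>x k\<bar> * \<bar>helmert k j\<bar> \<le> sqrt (Nsq d x) * 1"
      by (intro mult_mono abs_helmert_le) auto
    then show "\<bar>x k * helmert k j\<bar> \<le> sqrt (Nsq d x)" by (simp add: abs_mult)
  qed
  finally show ?thesis by simp
qed

lemma hinv_eq_dir: "hinv d x j = hinv d x j / sqrt (Nsq d x) * sqrt (Nsq d x)"
  using abs_hinv_le[of d x j] by (cases "Nsq d x = 0") auto

lemma hinv_dir_indep:
  assumes d: "d \<ge> 1" and [measurable]: "h \<in> borel_measurable borel"
  shows "(\<integral>\<^sup>+x. ennreal ((hinv d x j / sqrt (Nsq d x)) ^ (2 * p)) * h (Nsq d x) \<partial>gaussN d) =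
    (\<integral>\<^sup>+x. ennreal ((hinv d x j / sqrt (Nsq d x)) ^ (2 * p)) \<partial>gaussN d) * (\<integral>\<^sup>+x. h (Nsq d x) \<partial>gaussN d)"
proof (rule gauss_radial_indep(2)[OF d])
  have [measurable]: "(\<lambda>x. hinv d x j) \<in> borel_measurable (lebN d)"
    by (rule measurable_hinv) simp
  show "(\<lambda>x. ennreal ((hinv d x j / sqrt (Nsq d x)) ^ (2 * p))) \<in> borel_measurable (lebN d)"
    by measurable
  show "ennreal ((hinv d (\<lambda>i\<in>{..<d}. c * x i) j / sqrt (Nsq d (\<lambda>i\<in>{..<d}. c * x i))) ^ (2 * p))
      = ennreal ((hinv d x j / sqrt (Nsq d x)) ^ (2 * p))" if "c > 0" for c x
    using that unfolding hinv_scale Nsq_scale by (simp add: real_sqrt_mult)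
  show "ennreal ((hinv d x j / sqrt (Nsq d x)) ^ (2 * p)) \<le> ennreal (real d ^ (2 * p))" for x
  proof -
    have "\<bar>hinv d x j / sqrt (Nsq d x)\<bar> \<le> real d"
      using abs_hinv_le[of d x j] by (cases "Nsq d x = 0") (auto simp: abs_divide divide_le_eq less_le)
    then have "\<bar>hinv d x j / sqrt (Nsq d x)\<bar> ^ (2 * p) \<le> real d ^ (2 * p)"
      by (intro power_mono) auto
    then show ?thesis by (intro ennreal_leI) (simp only: power_mult power2_abs)
  qed
qed simp

text \<open>By independence the moment of the direction times that of the radius is the moment of
  \<open>hinv\<close>; the radius contributes at least d^p.\<close>

lemma hinv_dir_moment:
  assumes n: "n \<ge> 2" and j: "j < n"
  shows "(\<integral>\<^sup>+x. ennreal ((hinv (n - 1) x j / sqrt (Nsq (n - 1) x)) ^ (2 * p)) \<partial>gaussN (n - 1))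
    \<le> ennreal (2 * 4 ^ p * gmom p / real (n - 1) ^ p)"
proof -
  define d where "d = n - 1"
  have d: "d \<ge> 1" using n by (simp add: d_def)
  define E where "E = (\<integral>\<^sup>+x. ennreal ((hinv d x j / sqrt (Nsq d x)) ^ (2 * p)) \<partial>gaussN d)"
  have "E * ennreal (real d ^ p) \<le> E * (\<integral>\<^sup>+x. ennreal (Nsq d x ^ p) \<partial>gaussN d)"
    by (intro mult_left_mono nn_integral_Nsq_power_ge d) simp
  also have "\<dots> = (\<integral>\<^sup>+x. ennreal ((hinv d x j / sqrt (Nsq d x)) ^ (2 * p)) * ennreal (Nsq d x ^ p) \<partial>gaussN d)"
    unfolding E_def by (rule hinv_dir_indep[OF d, symmetric]) measurable
  also have "\<dots> = (\<integral>\<^sup>+x. ennreal (hinv d x j ^ (2 * p)) \<partial>gaussN d)"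
  proof (rule nn_integral_cong)
    fix x
    have "hinv d x j ^ (2 * p) = (hinv d x j / sqrt (Nsq d x) * sqrt (Nsq d x)) ^ (2 * p)"
      using hinv_eq_dir by metis
    also have "\<dots> = (hinv d x j / sqrt (Nsq d x)) ^ (2 * p) * (sqrt (Nsq d x)) ^ (2 * p)"
      by (rule power_mult_distrib)
    also have "(sqrt (Nsq d x)) ^ (2 * p) = Nsq d x ^ p"
      by (simp add: power_mult)
    finally show "ennreal ((hinv d x j / sqrt (Nsq d x)) ^ (2 * p)) * ennreal (Nsq d x ^ p) = ennreal (hinv d x j ^ (2 * p))"
      by (simp add: ennreal_mult')
  qed
  also have "\<dots> \<le> ennreal (2 * 4 ^ p * gmom p)"
    unfolding d_def by (rule hinv_moment[OF n j])
  finally have *: "E * ennreal (real d ^ p) \<le> ennreal (2 * 4 ^ p * gmom p)" .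
  have "E = E * ennreal (real d ^ p) * ennreal (1 / real d ^ p)"
    using d by (simp add: mult.assoc flip: ennreal_mult')
  also have "\<dots> \<le> ennreal (2 * 4 ^ p * gmom p) * ennreal (1 / real d ^ p)"
    by (intro mult_right_mono *) simp
  also have "\<dots> = ennreal (2 * 4 ^ p * gmom p / real d ^ p)"
    by (simp flip: ennreal_mult')
  finally show ?thesis by (simp only: E_def d_def)
qed

lemma measurable_hinv_gauss [measurable]: "(\<lambda>x. hinv d x j) \<in> borel_measurable (lebN d)"
  by (rule measurable_hinv) simp

text \<open>The constant 8^p is the 4^p of \<open>hinv_moment\<close> times 2^p, which bounds (n /
  (n - 1))^p.\<close>

lemma mc_field_moment:
  assumes n: "n \<ge> 2" and j: "j < n"
  shows "(\<integral>\<^sup>+x. ennreal (mc_field n x j ^ (2 * p)) \<partial>gaussN n) \<le> ennreal (2 * 8 ^ p * gmom p)"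
proof -
  define d where "d = n - 1"
  have d: "d \<ge> 1" "d \<le> n" "real n \<le> 2 * real d" using n by (auto simp: d_def)
  let ?F = "\<lambda>x. ennreal ((hinv d x j / sqrt (Nsq d x)) ^ (2 * p))"
  have loc: "hinv d (restrict x {..<d}) j = hinv d x j" for x
    by (simp add: hinv_def)
  have "(\<integral>\<^sup>+x. ennreal (mc_field n x j ^ (2 * p)) \<partial>gaussN n) = (\<integral>\<^sup>+x. ennreal (real n ^ p) * ?F x \<partial>gaussN n)"
  proof (rule nn_integral_cong)
    fix x
    have "mc_field n x j ^ (2 * p) = real n ^ p * (hinv d x j / sqrt (Nsq d x)) ^ (2 * p)"
      unfolding mc_field_def d_def power_mult_distrib by (simp add: power_mult)
    then show "ennreal (mc_field n x j ^ (2 * p)) = ennreal (real n ^ p) * ?F x"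
      by (simp add: ennreal_mult')
  qed
  also have "\<dots> = (\<integral>\<^sup>+x. ennreal (real n ^ p) * ?F x \<partial>gaussN d)"
    by (rule nn_integral_gaussN_restrict) (use d in \<open>simp_all add: loc\<close>)
  also have "\<dots> = ennreal (real n ^ p) * (\<integral>\<^sup>+x. ?F x \<partial>gaussN d)"
    by (rule nn_integral_cmult) (simp add: measurable_cong_sets[OF sets_gaussN refl])
  also have "\<dots> \<le> ennreal (real n ^ p) * ennreal (2 * 4 ^ p * gmom p / real d ^ p)"
    unfolding d_def by (intro mult_left_mono hinv_dir_moment[OF n j]) simp
  also have "\<dots> = ennreal ((real n / real d) ^ p * (2 * 4 ^ p * gmom p))"
    by (simp add: power_divide flip: ennreal_mult')
  also have "\<dots> \<le> ennreal (2 ^ p * (2 * 4 ^ p * gmom p))"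
    using d by (intro ennreal_leI mult_right_mono power_mono) (auto simp: divide_le_eq)
  also have "2 ^ p * (2 * 4 ^ p * gmom p) = 2 * 8 ^ p * gmom p"
    using power_mult_distrib[of "2::real" 4 p] by simp
  finally show ?thesis .
qed

text \<open>Multiply by sqrt a + sqrt t, which is at least sqrt a. Fluctuations of the radius are
  thereby reduced to those of its square.\<close>

lemma sqrt_diff_sq_le:
  assumes "a > 0" "t \<ge> 0"
  shows "(sqrt a - sqrt t)\<^sup>2 \<le> (a - t)\<^sup>2 / a"
proof -
  have "a * (sqrt a - sqrt t)\<^sup>2 = (sqrt a * (sqrt a - sqrt t))\<^sup>2"
    using assms by (simp add: power_mult_distrib)
  also have "\<dots> \<le> ((sqrt a + sqrt t) * (sqrt a - sqrt t))\<^sup>2"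
    unfolding power_mult_distrib using assms by (intro mult_right_mono power_mono) auto
  also have "(sqrt a + sqrt t) * (sqrt a - sqrt t) = a - t"
    using assms by (simp add: algebra_simps)
  finally show ?thesis using assms by (simp add: pos_le_divide_eq mult.commute)
qed

text \<open>The constant is 50 = 2 * 24 + 2: the factor 2 comes from (u - v)^2 <= 2 u^2 + 2 v^2, the
  24 from direction times radius, and the last 2 from the mean of Z, whose variance is 1/n.\<close>

lemma mc_gc_field_dist:
  assumes n: "n \<ge> 2" and j: "j < n"
  shows "(\<integral>\<^sup>+x. ennreal ((mc_field n x j - gc_field n x j)\<^sup>2) \<partial>gaussN n) \<le> ennreal (50 / real n)"
proof -
  define d where "d = n - 1"
  have d: "d \<ge> 1" "d \<le> n" "d < n" "n = Suc d" using n by (auto simp: d_def)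
  let ?q = "\<lambda>x. hinv d x j / sqrt (Nsq d x)"
  have loc: "hinv d (restrict x {..<d}) j = hinv d x j" for x
    by (simp add: hinv_def)
  have mh [measurable]: "(\<lambda>x. hinv d x j) \<in> borel_measurable (gaussN n)" "Nsq d \<in> borel_measurable (gaussN n)"
      "(\<lambda>x. x d) \<in> borel_measurable (gaussN n)"
    using d by (auto simp: measurable_cong_sets[OF sets_gaussN refl] intro: measurable_hinv measurable_Nsq_le measurable_component_lebN)
  have pt: "(mc_field n x j - gc_field n x j)\<^sup>2 \<le> 2 * ((?q x) ^ (2 * 1) * (sqrt (real n) - sqrt (Nsq d x))\<^sup>2) + 2 / real n * (x d)\<^sup>2" for x
  proof -
    \<comment> \<open>Write \<open>hinv\<close> as q times the radius, so that the two fields differ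
      through sqrt n minus the radius.\<close>
    have e: "mc_field n x j - gc_field n x j = ?q x * (sqrt (real n) - sqrt (Nsq d x)) - x d / sqrt (real n)"
    proof -
      have mc: "mc_field n x j = sqrt (real n) * ?q x" and gc: "gc_field n x j = hinv d x j + x d / sqrt (real n)"
        by (simp_all only: mc_field_def gc_field_def d_def)
      have ring: "h = q * t \<Longrightarrow> u * q - (h + z) = q * (u - t) - z" for h q t u z :: real
        by (simp add: algebra_simps)
      show ?thesis
        unfolding mc gc using ring[OF hinv_eq_dir[of d x j]] by simp
    qed
    have "(u - v)\<^sup>2 \<le> 2 * u\<^sup>2 + 2 * v\<^sup>2" for u v :: real
      using zero_le_power2[of "u + v"] by (simp add: power2_eq_square algebra_simps)
    from this[of "?q x * (sqrt (real n) - sqrt (Nsq d x))" "x d / sqrt (real n)"] show ?thesis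
      unfolding e by (simp add: power_mult_distrib power_divide)
  qed
  have "(\<integral>\<^sup>+x. ennreal ((sqrt (real n) - sqrt (Nsq d x))\<^sup>2) \<partial>gaussN d) \<le> (\<integral>\<^sup>+x. ennreal (1 / real n) * ennreal ((real (Suc d) - Nsq d x)\<^sup>2) \<partial>gaussN d)"
    using d sqrt_diff_sq_le[of "real n" "Nsq d x" for x]
    by (intro nn_integral_mono) (auto intro!: ennreal_leI simp flip: ennreal_mult')
  also have "\<dots> = ennreal (1 / real n) * ennreal (2 * real d + 1)"
    by (subst nn_integral_cmult) (measurable, simp only: nn_integral_Nsq_variance)
  also have "\<dots> = ennreal ((2 * real d + 1) / real n)"
    by (subst ennreal_mult'[symmetric]) auto
  finally have rad: "(\<integral>\<^sup>+x. ennreal ((sqrt (real n) - sqrt (Nsq d x))\<^sup>2) \<partial>gaussN d) \<le> ennreal ((2 * real d + 1) / real n)" .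
  have "(\<integral>\<^sup>+x. ennreal ((?q x) ^ (2 * 1)) * ennreal ((sqrt (real n) - sqrt (Nsq d x))\<^sup>2) \<partial>gaussN n)
    = (\<integral>\<^sup>+x. ennreal ((?q x) ^ (2 * 1)) * ennreal ((sqrt (real n) - sqrt (Nsq d x))\<^sup>2) \<partial>gaussN d)"
    by (rule nn_integral_gaussN_restrict) (use d in \<open>simp_all add: loc\<close>)
  also have "\<dots> = (\<integral>\<^sup>+x. ennreal ((?q x) ^ (2 * 1)) \<partial>gaussN d) * (\<integral>\<^sup>+x. ennreal ((sqrt (real n) - sqrt (Nsq d x))\<^sup>2) \<partial>gaussN d)"
    by (rule hinv_dir_indep[OF d(1)]) measurable
  also have "\<dots> \<le> ennreal (2 * 4 ^ 1 * gmom 1 / real d ^ 1) * ennreal ((2 * real d + 1) / real n)"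
    using hinv_dir_moment[OF n j, of 1] rad unfolding d_def by (intro mult_mono) auto
  also have "\<dots> \<le> ennreal (24 / real n)"
  proof -
    \<comment> \<open>The 8 is 2 * 4 * \<open>gmom 1\<close>, and 2 d + 1 <= 3 d.\<close>
    have "8 / real d * ((2 * real d + 1) / real n) \<le> 24 / real n"
      using d(1) by (simp add: divide_simps d(4))
    then show ?thesis unfolding gmom_1
      by (simp flip: ennreal_mult' add: ennreal_leI)
  qed
  finally have main: "(\<integral>\<^sup>+x. ennreal ((?q x) ^ (2 * 1)) * ennreal ((sqrt (real n) - sqrt (Nsq d x))\<^sup>2) \<partial>gaussN n) \<le> ennreal (24 / real n)" .
  have last: "(\<integral>\<^sup>+x. ennreal ((x d)\<^sup>2) \<partial>gaussN n) = 1"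
    using nn_integral_gaussN_component[OF d(3), of "\<lambda>y. ennreal (y ^ (2 * 1))"]
    unfolding nn_integral_std_gauss_moment gmom_1 by simp
  have "(\<integral>\<^sup>+x. ennreal ((mc_field n x j - gc_field n x j)\<^sup>2) \<partial>gaussN n)
    \<le> (\<integral>\<^sup>+x. ennreal 2 * (ennreal ((?q x) ^ (2 * 1)) * ennreal ((sqrt (real n) - sqrt (Nsq d x))\<^sup>2)) + ennreal (2 / real n) * ennreal ((x d)\<^sup>2) \<partial>gaussN n)"
  proof (rule nn_integral_mono)
    fix x
    have comb: "ennreal 2 * (ennreal u * ennreal v) + ennreal w * ennreal z = ennreal (2 * (u * v) + w * z)"
      if "0 \<le> u" "0 \<le> v" "0 \<le> w" "0 \<le> z" for u v w z
      using that by (simp only: ennreal_mult[symmetric] ennreal_plus[symmetric] mult_nonneg_nonneg zero_le_numeral)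
    have "ennreal 2 * (ennreal ((?q x) ^ (2 * 1)) * ennreal ((sqrt (real n) - sqrt (Nsq d x))\<^sup>2)) + ennreal (2 / real n) * ennreal ((x d)\<^sup>2)
      = ennreal (2 * ((?q x) ^ (2 * 1) * (sqrt (real n) - sqrt (Nsq d x))\<^sup>2) + 2 / real n * (x d)\<^sup>2)"
      by (rule comb) simp_all
    then show "ennreal ((mc_field n x j - gc_field n x j)\<^sup>2) \<le>
      ennreal 2 * (ennreal ((?q x) ^ (2 * 1)) * ennreal ((sqrt (real n) - sqrt (Nsq d x))\<^sup>2)) + ennreal (2 / real n) * ennreal ((x d)\<^sup>2)"
      using pt[of x] by (simp only: ennreal_leI)
  qed
  also have "\<dots> = ennreal 2 * (\<integral>\<^sup>+x. ennreal ((?q x) ^ (2 * 1)) * ennreal ((sqrt (real n) - sqrt (Nsq d x))\<^sup>2) \<partial>gaussN n)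
      + ennreal (2 / real n) * (\<integral>\<^sup>+x. ennreal ((x d)\<^sup>2) \<partial>gaussN n)"
    by (simp add: nn_integral_add nn_integral_cmult)
  also have "\<dots> \<le> ennreal 2 * ennreal (24 / real n) + ennreal (2 / real n) * 1"
    unfolding last by (intro add_mono mult_left_mono main) auto
  also have "\<dots> = ennreal (50 / real n)"
    by (subst mult_1_right, subst ennreal_mult'[symmetric], simp, subst ennreal_plus[symmetric]) (auto simp: add_divide_distrib[symmetric])
  finally show ?thesis .
qed

section \<open>Test functions of polynomial growth\<close>

text \<open>One application of \<open>power_even_add_le\<close> per index, whence the exponent
  \<open>p * card S\<close>.\<close>

lemma sum_power_even_le:
  fixes g :: "'i \<Rightarrow> real"
  assumes "finite S"
  shows "(1 + (\<Sum>i\<in>S. g i)) ^ (2 * p) \<le> 4 ^ (p * card S) * (1 + (\<Sum>i\<in>S. g i ^ (2 * p)))"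
  using assms
proof induction
  case (insert x S)
  have nn: "0 \<le> (\<Sum>i\<in>S. g i ^ (2 * p))"
    by (intro sum_nonneg) (simp add: power_mult)
  have "(1 + (\<Sum>i\<in>insert x S. g i)) ^ (2 * p) = (g x + (1 + (\<Sum>i\<in>S. g i))) ^ (2 * p)"
    using insert by (simp add: add_ac)
  also have "\<dots> \<le> 4 ^ p * (g x ^ (2 * p) + (1 + (\<Sum>i\<in>S. g i)) ^ (2 * p))"
    by (rule power_even_add_le)
  also have "\<dots> \<le> 4 ^ p * (4 ^ (p * card S) * g x ^ (2 * p) + 4 ^ (p * card S) * (1 + (\<Sum>i\<in>S. g i ^ (2 * p))))"
  proof (intro mult_left_mono add_mono insert.IH)
    have "1 * g x ^ (2 * p) \<le> 4 ^ (p * card S) * g x ^ (2 * p)"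
      by (intro mult_right_mono) (auto simp: power_mult)
    then show "g x ^ (2 * p) \<le> 4 ^ (p * card S) * g x ^ (2 * p)" by simp
  qed simp
  also have "\<dots> = 4 ^ (p * card (insert x S)) * (1 + (\<Sum>i\<in>insert x S. g i ^ (2 * p)))"
    using insert by (simp add: power_add algebra_simps)
  finally show ?case .
qed simp

text \<open>Factors are exchanged one at a time; each exchange costs one coordinate difference times
  factors bounded by ?M. The 1 in ?M lets lower powers be raised to the common one.\<close>

lemma monomial_growth:
  fixes a b :: "real ^ 'k"
  shows "\<bar>(\<Prod>l<K. a $ j l) - (\<Prod>l<K. b $ j l)\<bar>
    \<le> real K * (\<Sum>i\<in>UNIV. \<bar>a $ i - b $ i\<bar>) * (1 + (\<Sum>i\<in>UNIV. \<bar>a $ i\<bar> + \<bar>b $ i\<bar>)) ^ K"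
    (is "_ \<le> _ * ?D * ?M ^ _")
proof (induction K)
  case 0
  then show ?case by simp
next
  case (Suc K)
  have "?D \<ge> 0" by (intro sum_nonneg) auto
  have nn: "0 \<le> (\<Sum>i\<in>UNIV. \<bar>a $ i\<bar> + \<bar>b $ i\<bar>)" by (intro sum_nonneg) auto
  then have M: "?M \<ge> 1" by simp
  have le: "\<bar>a $ i\<bar> + \<bar>b $ i\<bar> \<le> ?M" for i
    using member_le_sum[of i UNIV "\<lambda>i. \<bar>a $ i\<bar> + \<bar>b $ i\<bar>"] by simp
  have aM: "\<bar>a $ i\<bar> \<le> ?M" and bM: "\<bar>b $ i\<bar> \<le> ?M" for i
    using le[of i] by auto
  have d: "\<bar>a $ i - b $ i\<bar> \<le> ?D" for i
    using member_le_sum[of i UNIV "\<lambda>i. \<bar>a $ i - b $ i\<bar>"] by simp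
  have pb: "\<bar>\<Prod>l<K. b $ j l\<bar> \<le> ?M ^ K"
  proof -
    have "\<bar>\<Prod>l<K. b $ j l\<bar> \<le> (\<Prod>l<K. ?M)"
      unfolding abs_prod by (intro prod_mono) (auto simp: bM)
    then show ?thesis by simp
  qed
  let ?A = "\<Prod>l<K. a $ j l" and ?B = "\<Prod>l<K. b $ j l"
  have "\<bar>?A * a $ j K - ?B * b $ j K\<bar> = \<bar>(?A - ?B) * a $ j K + ?B * (a $ j K - b $ j K)\<bar>"
    by (simp add: algebra_simps)
  also have "\<dots> \<le> \<bar>?A - ?B\<bar> * \<bar>a $ j K\<bar> + \<bar>?B\<bar> * \<bar>a $ j K - b $ j K\<bar>"
    by (rule order_trans[OF abs_triangle_ineq]) (simp add: abs_mult)
  also have "\<dots> \<le> (real K * ?D * ?M ^ K) * ?M + ?M ^ K * ?D"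
    using Suc.IH aM pb d M \<open>?D \<ge> 0\<close> by (intro add_mono mult_mono) auto
  also have "?M ^ K * ?D \<le> ?D * ?M ^ Suc K"
    using M \<open>?D \<ge> 0\<close> power_increasing[of K "Suc K" ?M] by (simp only: mult.commute[of _ ?D]) (intro mult_left_mono, auto)
  finally show ?case by (simp add: algebra_simps)
qed

text \<open>The bound holds for every weight r, since r will depend on the volume. Only even powers
  appear, which are the quantities with known moments.\<close>

definition sq_growth :: "real \<Rightarrow> nat \<Rightarrow> (real ^ 'k \<Rightarrow> real) \<Rightarrow> bool" where
  "sq_growth C p f \<longleftrightarrow> C \<ge> 0 \<and> (\<forall>a b. \<forall>r>0. \<bar>f a - f b\<bar> \<le>
    C * (r * (\<Sum>i\<in>UNIV. (a $ i - b $ i) ^ 2) + (1 + (\<Sum>i\<in>UNIV. a $ i ^ (2 * p) + b $ i ^ (2 * p))) / r))"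

text \<open>Young's inequality with a free weight \<open>r\<close>, later chosen as the square root of the volume.\<close>

lemma sq_growthI:
  fixes f :: "real ^ 'k \<Rightarrow> real"
  assumes K: "K \<ge> 0" and g: "\<And>a b. \<bar>f a - f b\<bar> \<le>
    K * (\<Sum>i\<in>UNIV. \<bar>a $ i - b $ i\<bar>) * (1 + (\<Sum>i\<in>UNIV. \<bar>a $ i\<bar> + \<bar>b $ i\<bar>)) ^ p"
  shows "\<exists>C. sq_growth C p f"
proof -
  define c where "c = real CARD('k)"
  \<comment> \<open>The first factor comes from the sum over coordinates, the second from splitting
    each |a_i| + |b_i|.\<close>
  define L where "L = (4::real) ^ (p * CARD('k)) * 4 ^ p"
  have c: "c \<ge> 1" unfolding c_def by (simp add: Suc_leI)
  have L: "L \<ge> 1" by (simp add: L_def one_le_power mult_ge1_I)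
  show ?thesis
  proof (intro exI[of _ "K * (c + L)"], unfold sq_growth_def, intro conjI allI impI)
    show "0 \<le> K * (c + L)" using K c L by simp
    fix a b :: "real ^ 'k" and r :: real assume r: "r > 0"
    define D where "D = (\<Sum>i\<in>UNIV. \<bar>a $ i - b $ i\<bar>)"
    define X where "X = (1 + (\<Sum>i\<in>UNIV. \<bar>a $ i\<bar> + \<bar>b $ i\<bar>)) ^ p"
    define S where "S = (\<Sum>i\<in>UNIV. (a $ i - b $ i) ^ 2)"
    define Q where "Q = (1 + (\<Sum>i\<in>UNIV. a $ i ^ (2 * p) + b $ i ^ (2 * p)))"
    have S: "S \<ge> 0" unfolding S_def by (intro sum_nonneg) auto
    have Q: "Q \<ge> 0" unfolding Q_def by (intro add_nonneg_nonneg sum_nonneg) (auto simp: power_mult)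
    have D2: "D\<^sup>2 \<le> c * S"
      using sum_squared_le_sum_of_squares[of "\<lambda>i. \<bar>a $ i - b $ i\<bar>" UNIV]
      by (simp add: D_def c_def S_def mult.commute)
    have X2: "X\<^sup>2 \<le> L * Q"
    proof -
      have "X\<^sup>2 = (1 + (\<Sum>i\<in>UNIV. \<bar>a $ i\<bar> + \<bar>b $ i\<bar>)) ^ (2 * p)"
        by (simp add: X_def power_mult[symmetric] mult.commute)
      also have "\<dots> \<le> 4 ^ (p * CARD('k)) * (1 + (\<Sum>i\<in>UNIV. (\<bar>a $ i\<bar> + \<bar>b $ i\<bar>) ^ (2 * p)))"
        by (rule sum_power_even_le) simp
      also have "\<dots> \<le> 4 ^ (p * CARD('k)) * (4 ^ p * 1 + (\<Sum>i\<in>UNIV. 4 ^ p * (a $ i ^ (2 * p) + b $ i ^ (2 * p))))"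
      proof (intro mult_left_mono add_mono sum_mono)
        fix i
        show "(\<bar>a $ i\<bar> + \<bar>b $ i\<bar>) ^ (2 * p) \<le> 4 ^ p * (a $ i ^ (2 * p) + b $ i ^ (2 * p))"
          using power_even_add_le[of "\<bar>a $ i\<bar>" "\<bar>b $ i\<bar>" p] by (simp add: power_mult)
      qed auto
      also have "\<dots> = L * Q"
        by (simp only: L_def Q_def sum_distrib_left[symmetric] distrib_left[symmetric] mult.assoc)
      finally show ?thesis .
    qed
    have "\<bar>f a - f b\<bar> \<le> K * (D * X)" using g[of a b] by (simp add: D_def X_def mult.assoc)
    also have "D * X \<le> r * D\<^sup>2 + X\<^sup>2 / r"
    proof -
      have "2 * (r * D) * X \<le> (r * D)\<^sup>2 + X\<^sup>2"
        using zero_le_power2[of "r * D - X"] by (simp add: power2_diff)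
      moreover have "0 \<le> (r * D)\<^sup>2 + X\<^sup>2" by simp
      ultimately have "r * (D * X) \<le> (r * D)\<^sup>2 + X\<^sup>2" by (simp only: mult.assoc)
      also have "\<dots> = r * (r * D\<^sup>2 + X\<^sup>2 / r)"
        using r by (simp add: power2_eq_square algebra_simps)
      finally show ?thesis using r by simp
    qed
    also have "r * D\<^sup>2 + X\<^sup>2 / r \<le> r * (c * S) + L * Q / r"
      using r by (intro add_mono mult_left_mono divide_right_mono D2 X2) auto
    also have "\<dots> \<le> (c + L) * (r * S) + (c + L) * (Q / r)"
    proof -
      have "c * (r * S) \<le> (c + L) * (r * S)" "L * (Q / r) \<le> (c + L) * (Q / r)"
        using c L r S Q by (auto intro!: mult_right_mono simp del: times_divide_eq_right)
      then show ?thesis by (simp add: mult_ac)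
    qed
    finally have "\<bar>f a - f b\<bar> \<le> K * ((c + L) * (r * S) + (c + L) * (Q / r))"
      using K by (simp only: mult_left_mono)
    then show "\<bar>f a - f b\<bar> \<le> K * (c + L) * (r * (\<Sum>i\<in>UNIV. (a $ i - b $ i)\<^sup>2) +
        (1 + (\<Sum>i\<in>UNIV. a $ i ^ (2 * p) + b $ i ^ (2 * p))) / r)"
      unfolding S_def[symmetric] Q_def[symmetric] by (simp only: distrib_left[of "c + L", symmetric] mult.assoc)
  qed
qed

lemma sq_growth_lipschitz:
  fixes f :: "real ^ 'k \<Rightarrow> real"
  assumes "1-lipschitz_on UNIV f"
  shows "\<exists>C. sq_growth C 0 f"
proof (rule sq_growthI[of 1])
  fix a b :: "real ^ 'k"
  have "\<bar>f a - f b\<bar> \<le> norm (a - b)"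
    using lipschitz_onD[OF assms, of a b] by (simp add: dist_norm)
  also have "\<dots> \<le> (\<Sum>i\<in>UNIV. \<bar>a $ i - b $ i\<bar>)"
    using norm_le_l1_cart[of "a - b"] by simp
  finally show "\<bar>f a - f b\<bar> \<le> 1 * (\<Sum>i\<in>UNIV. \<bar>a $ i - b $ i\<bar>) * (1 + (\<Sum>i\<in>UNIV. \<bar>a $ i\<bar> + \<bar>b $ i\<bar>)) ^ 0"
    by simp
qed simp

section \<open>From moment bounds to expectations of test functions\<close>

lemma integrable_of_nn_integral_le:
  fixes g :: "'z \<Rightarrow> real"
  assumes "g \<in> borel_measurable M" "\<And>x. 0 \<le> g x" "(\<integral>\<^sup>+x. ennreal (g x) \<partial>M) \<le> ennreal c" "c \<ge> 0"
  shows "integrable M g" "(\<integral>x. g x \<partial>M) \<le> c"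
proof -
  show "integrable M g"
    using assms by (intro integrableI_nonneg) (auto intro: le_less_trans)
  show "(\<integral>x. g x \<partial>M) \<le> c"
    using assms(3,4) by (rule integral_real_bounded[rotated])
qed

lemma (in prob_space) affine_even_moment:
  fixes X :: "'a \<Rightarrow> real"
  assumes [measurable]: "X \<in> borel_measurable M" and c: "c \<ge> 0"
    and X: "(\<integral>\<^sup>+x. ennreal (X x ^ (2 * p)) \<partial>M) \<le> ennreal c"
  shows "integrable M (\<lambda>x. (m + s * X x) ^ (2 * p))"
    "(\<integral>x. (m + s * X x) ^ (2 * p) \<partial>M) \<le> 4 ^ p * (m ^ (2 * p) + s ^ (2 * p) * c)"
proof -
  have int: "integrable M (\<lambda>x. X x ^ (2 * p))" and le: "(\<integral>x. X x ^ (2 * p) \<partial>M) \<le> c"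
    using c X by (auto intro!: integrable_of_nn_integral_le simp: power_mult)
  have pt: "(m + s * X x) ^ (2 * p) \<le> 4 ^ p * (m ^ (2 * p) + s ^ (2 * p) * X x ^ (2 * p))" for x
    using power_even_add_le[of m "s * X x" p] by (simp add: power_mult_distrib)
  have nn: "0 \<le> (m + s * X x) ^ (2 * p)" for x by (simp add: power_mult)
  have int2: "integrable M (\<lambda>x. 4 ^ p * (m ^ (2 * p) + s ^ (2 * p) * X x ^ (2 * p)))"
    using int by simp
  show int3: "integrable M (\<lambda>x. (m + s * X x) ^ (2 * p))"
    by (rule Bochner_Integration.integrable_bound[OF int2]) (use pt nn in \<open>auto intro: order_trans[OF _ abs_ge_self]\<close>)
  have "(\<integral>x. (m + s * X x) ^ (2 * p) \<partial>M) \<le> (\<integral>x. 4 ^ p * (m ^ (2 * p) + s ^ (2 * p) * X x ^ (2 * p)) \<partial>M)"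
    by (intro integral_mono int2 int3 pt)
  also have "\<dots> = 4 ^ p * (m ^ (2 * p) + s ^ (2 * p) * (\<integral>x. X x ^ (2 * p) \<partial>M))"
    using int by (simp add: prob_space)
  also have "\<dots> \<le> 4 ^ p * (m ^ (2 * p) + s ^ (2 * p) * c)"
    using le by (intro mult_left_mono add_mono) (auto simp: power_mult)
  finally show "(\<integral>x. (m + s * X x) ^ (2 * p) \<partial>M) \<le> 4 ^ p * (m ^ (2 * p) + s ^ (2 * p) * c)" .
qed

lemma measurable_proj_I:
  fixes \<iota> :: "'k::finite \<Rightarrow> nat"
  assumes "range \<iota> \<subseteq> {..<n}"
  shows "proj_I \<iota> \<in> borel_measurable (lebN n)"
proof (rule borel_measurable_euclidean_space[THEN iffD2], intro ballI)
  fix e :: "real ^ 'k" assume "e \<in> Basis"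
  have "(\<lambda>x. proj_I \<iota> x \<bullet> e) = (\<lambda>x. \<Sum>i\<in>UNIV. x (\<iota> i) * e $ i)"
    by (simp add: inner_vec_def proj_I_def fun_eq_iff)
  moreover have "\<And>i. \<iota> i < n" using assms by auto
  then have "(\<lambda>x. \<Sum>i\<in>UNIV. x (\<iota> i) * e $ i) \<in> borel_measurable (lebN n)"
    by (intro borel_measurable_sum borel_measurable_times measurable_component_lebN) auto
  ultimately show "(\<lambda>x. proj_I \<iota> x \<bullet> e) \<in> borel_measurable (lebN n)" by simp
qed

text \<open>The growth bound integrated along the coupling with r = sqrt n: squared differences
  contribute sqrt n times O(1/n), moments contribute O(1) over sqrt n.\<close>

lemma sq_growth_field_diff:
  fixes f :: "real ^ 'k \<Rightarrow> real" and m s :: real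
  assumes f: "sq_growth C p f" and [measurable]: "f \<in> borel_measurable borel"
    and n: "n \<ge> 2" and \<iota>: "range \<iota> \<subseteq> {..<n}"
  defines "c \<equiv> \<lambda>q. 2 * 8 ^ q * gmom q"
  defines "W \<equiv> 4 ^ p * (m ^ (2 * p) + s ^ (2 * p) * c p)"
  shows "\<bar>(\<integral>x. f (\<chi> i. m + s * mc_field n x (\<iota> i)) \<partial>gaussN n) - (\<integral>x. f (\<chi> i. m + s * gc_field n x (\<iota> i)) \<partial>gaussN n)\<bar>
    \<le> C * (50 * real CARD('k) * s\<^sup>2 + 1 + 2 * real CARD('k) * W) / sqrt (real n)"
proof -
  interpret prob_space "gaussN n" by (rule prob_space_gaussN)
  let ?k = "real CARD('k)"
  have C: "C \<ge> 0" and g: "\<And>a b r. r > 0 \<Longrightarrow> \<bar>f a - f b\<bar> \<le>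
    C * (r * (\<Sum>i\<in>UNIV. (a $ i - b $ i) ^ 2) + (1 + (\<Sum>i\<in>UNIV. a $ i ^ (2 * p) + b $ i ^ (2 * p))) / r)"
    using f unfolding sq_growth_def by auto
  have cp: "c q \<ge> 0" for q by (simp add: c_def)
  have \<iota>n: "\<iota> i < n" for i using \<iota> by auto
  define a where "a x = (\<chi> i. m + s * mc_field n x (\<iota> i))" for x
  define b where "b x = (\<chi> i. m + s * gc_field n x (\<iota> i))" for x
  have mm [measurable]: "(\<lambda>x. mc_field n x j) \<in> borel_measurable (gaussN n)" "(\<lambda>x. gc_field n x j) \<in> borel_measurable (gaussN n)" for j
    using n by (auto simp: measurable_cong_sets[OF sets_gaussN refl])
  have vec: "(\<lambda>x. \<chi> i. m + s * F x (\<iota> i)) \<in> borel_measurable (gaussN n)"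
    if [measurable]: "\<And>j. (\<lambda>x. F x j) \<in> borel_measurable (gaussN n)" for F :: "(nat \<Rightarrow> real) \<Rightarrow> nat \<Rightarrow> real"
  proof -
    have "(\<lambda>x. \<lambda>j\<in>{..<n}. m + s * F x j) \<in> measurable (gaussN n) (lebN n)"
      by (rule measurable_into_lebN) auto
    from measurable_compose[OF this measurable_proj_I[OF \<iota>]] show ?thesis
      by (simp add: proj_I_def \<iota>n)
  qed
  have [measurable]: "a \<in> borel_measurable (gaussN n)" "b \<in> borel_measurable (gaussN n)"
    unfolding a_def[abs_def] b_def[abs_def] by (auto intro!: vec)
  have am: "integrable (gaussN n) (\<lambda>x. a x $ i ^ (2 * q))" "(\<integral>x. a x $ i ^ (2 * q) \<partial>gaussN n) \<le> 4 ^ q * (m ^ (2 * q) + s ^ (2 * q) * c q)" for i q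
    unfolding a_def vec_lambda_beta c_def
    by (rule affine_even_moment[OF mm(1) _ mc_field_moment[OF n \<iota>n]]; simp)+
  \<comment> \<open>The exact Gaussian moment is enlarged to the microcanonical bound so that one W
    serves both fields.\<close>
  have gcm: "(\<integral>\<^sup>+x. ennreal (gc_field n x j ^ (2 * q)) \<partial>gaussN n) \<le> ennreal (2 * 8 ^ q * gmom q)" if "j < n" for j q
  proof -
    have "(\<integral>\<^sup>+x. ennreal (gc_field n x j ^ (2 * q)) \<partial>gaussN n) = ennreal (gmom q)"
      using nn_integral_gc_field[OF that, of "\<lambda>y. ennreal (y ^ (2 * q))"] by (simp add: nn_integral_std_gauss_moment)
    also have "1 * gmom q \<le> (2 * 8 ^ q) * gmom q"
    proof (rule mult_right_mono)
      have "1 \<le> (8::real) ^ q" by (rule one_le_power) simp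
      then show "1 \<le> 2 * (8::real) ^ q" by linarith
    qed simp
    then have "ennreal (gmom q) \<le> ennreal (2 * 8 ^ q * gmom q)" by (intro ennreal_leI) simp
    finally show ?thesis .
  qed
  have bm: "integrable (gaussN n) (\<lambda>x. b x $ i ^ (2 * q))" "(\<integral>x. b x $ i ^ (2 * q) \<partial>gaussN n) \<le> 4 ^ q * (m ^ (2 * q) + s ^ (2 * q) * c q)" for i q
    unfolding b_def vec_lambda_beta c_def
    by (rule affine_even_moment[OF mm(2) _ gcm[OF \<iota>n]]; simp)+
  have dm: "integrable (gaussN n) (\<lambda>x. (a x $ i - b x $ i)\<^sup>2)" "(\<integral>x. (a x $ i - b x $ i)\<^sup>2 \<partial>gaussN n) \<le> s\<^sup>2 * (50 / real n)" for i
  proof -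
    have "integrable (gaussN n) (\<lambda>x. (mc_field n x (\<iota> i) - gc_field n x (\<iota> i))\<^sup>2)"
      "(\<integral>x. (mc_field n x (\<iota> i) - gc_field n x (\<iota> i))\<^sup>2 \<partial>gaussN n) \<le> 50 / real n"
      by (rule integrable_of_nn_integral_le[OF _ _ mc_gc_field_dist[OF n \<iota>n]]; simp)+
    moreover have "(a x $ i - b x $ i)\<^sup>2 = s\<^sup>2 * (mc_field n x (\<iota> i) - gc_field n x (\<iota> i))\<^sup>2" for x
      by (simp add: a_def b_def power_mult_distrib[symmetric] algebra_simps)
    ultimately show "integrable (gaussN n) (\<lambda>x. (a x $ i - b x $ i)\<^sup>2)" "(\<integral>x. (a x $ i - b x $ i)\<^sup>2 \<partial>gaussN n) \<le> s\<^sup>2 * (50 / real n)"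
      using mult_left_mono[of _ "50 / real n" "s\<^sup>2"] by simp_all
  qed
  have int: "integrable (gaussN n) (\<lambda>x. f (h x))"
    if hm: "\<And>i q. integrable (gaussN n) (\<lambda>x. h x $ i ^ (2 * q))" and [measurable]: "h \<in> borel_measurable (gaussN n)" for h
  proof -
    \<comment> \<open>The dominating function is the growth bound against b = 0 with weight r =
      1.\<close>
    have "integrable (gaussN n) (\<lambda>x. \<bar>f 0\<bar> + C * ((\<Sum>i\<in>UNIV. h x $ i ^ (2 * 1)) + (1 + (\<Sum>i\<in>UNIV. h x $ i ^ (2 * p) + 0 ^ (2 * p)))))"
      by (intro Bochner_Integration.integrable_add integrable_const integrable_mult_right Bochner_Integration.integrable_sum hm)
    then show ?thesis
    proof (rule Bochner_Integration.integrable_bound)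
      show "AE x in gaussN n. norm (f (h x)) \<le> norm (\<bar>f 0\<bar> + C * ((\<Sum>i\<in>UNIV. h x $ i ^ (2 * 1)) + (1 + (\<Sum>i\<in>UNIV. h x $ i ^ (2 * p) + 0 ^ (2 * p)))))"
      proof (rule AE_I2)
        fix x
        show "norm (f (h x)) \<le> norm (\<bar>f 0\<bar> + C * ((\<Sum>i\<in>UNIV. h x $ i ^ (2 * 1)) + (1 + (\<Sum>i\<in>UNIV. h x $ i ^ (2 * p) + 0 ^ (2 * p)))))"
          using g[of 1 "h x" 0] by simp
      qed
    qed measurable
  qed
  have ia: "integrable (gaussN n) (\<lambda>x. f (a x))" and ib: "integrable (gaussN n) (\<lambda>x. f (b x))"
    by (rule int, rule am, measurable, rule int, rule bm, measurable)
  let ?r = "sqrt (real n)"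
  have r: "?r > 0" using n by simp
  let ?R = "\<lambda>x. C * (?r * (\<Sum>i\<in>UNIV. (a x $ i - b x $ i)\<^sup>2) + (1 + (\<Sum>i\<in>UNIV. a x $ i ^ (2 * p) + b x $ i ^ (2 * p))) / ?r)"
  have iR: "integrable (gaussN n) ?R"
    by (intro Bochner_Integration.integrable_add integrable_const integrable_mult_right integrable_divide
        Bochner_Integration.integrable_sum am bm dm)
  have "\<bar>(\<integral>x. f (a x) \<partial>gaussN n) - (\<integral>x. f (b x) \<partial>gaussN n)\<bar> = \<bar>\<integral>x. f (a x) - f (b x) \<partial>gaussN n\<bar>"
    using ia ib by simp
  also have "\<dots> \<le> (\<integral>x. \<bar>f (a x) - f (b x)\<bar> \<partial>gaussN n)"
    by (rule integral_abs_bound)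
  also have "\<dots> \<le> (\<integral>x. ?R x \<partial>gaussN n)"
    using ia ib by (intro integral_mono iR g r) auto
  also have "\<dots> = C * (?r * (\<Sum>i\<in>UNIV. \<integral>x. (a x $ i - b x $ i)\<^sup>2 \<partial>gaussN n) +
      (1 + (\<Sum>i\<in>UNIV. (\<integral>x. a x $ i ^ (2 * p) \<partial>gaussN n) + (\<integral>x. b x $ i ^ (2 * p) \<partial>gaussN n))) / ?r)"
    using am bm dm prob_space by simp
  also have "\<dots> \<le> C * (?r * (\<Sum>i::'k\<in>UNIV. s\<^sup>2 * (50 / real n)) + (1 + (\<Sum>i::'k\<in>UNIV. W + W)) / ?r)"
    unfolding W_def
    by (intro mult_left_mono add_mono divide_right_mono sum_mono am bm dm order_refl C less_imp_le[OF r])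
  also have "\<dots> = C * (50 * ?k * s\<^sup>2 + 1 + 2 * ?k * W) / ?r"
  proof -
    have "?r * (?k * (s\<^sup>2 * (50 / real n))) = 50 * ?k * s\<^sup>2 / ?r"
      using n real_sqrt_pow2[of "real n"] by (simp add: field_simps power2_eq_square)
    then show ?thesis by (simp add: add_divide_distrib[symmetric] mult.assoc)
  qed
  finally show ?thesis by (simp only: a_def b_def)
qed

theorem theorem4p28:
  fixes \<rho> m \<mu> \<eta> :: real and f :: "real ^ 'k \<Rightarrow> real"
  assumes "\<rho> > 0" and "m\<^sup>2 < \<rho>"
    and "\<mu> = - m / (\<rho> - m\<^sup>2)" and "\<eta> = 1 / (2 * (\<rho> - m\<^sup>2))"
    and "(bounded (range f) \<and> 1-lipschitz_on UNIV f) \<or>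
         (\<exists>(K::nat) (j::nat \<Rightarrow> 'k). f = (\<lambda>y. \<Prod>l<K. y $ j l))"
  shows "\<exists>C N0. \<forall>N \<ge> N0. \<forall>\<iota> :: 'k \<Rightarrow> nat. inj \<iota> \<and> range \<iota> \<subseteq> {..<N} \<longrightarrow>
           \<bar>(\<integral>\<phi>. f (proj_I \<iota> \<phi>) \<partial>mc_measure N m \<rho>)
            - (\<integral>\<phi>. f (proj_I \<iota> \<phi>) \<partial>gc_measure N \<mu> \<eta>)\<bar> \<le> C / sqrt (real N)"
proof -
  define s where "s = sqrt (\<rho> - m\<^sup>2)"
  have s: "s > 0" "s\<^sup>2 = \<rho> - m\<^sup>2" using assms(2) by (auto simp: s_def)
  have cont: "continuous_on UNIV f"
    using assms(5) by (auto intro!: continuous_intros intro: lipschitz_on_continuous_on)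
  then have [measurable]: "f \<in> borel_measurable borel"
    by (rule borel_measurable_continuous_onI)
  obtain C p where f: "sq_growth C p f"
  proof -
    have "\<exists>C. sq_growth C K (\<lambda>y :: real ^ 'k. \<Prod>l<K. y $ j l)" for K and j :: "nat \<Rightarrow> 'k"
      by (rule sq_growthI[OF _ monomial_growth]) simp
    then show ?thesis using assms(5) sq_growth_lipschitz that by blast
  qed
  \<comment> \<open>The constant involves f, m, \<rho> and the number of indices, not \<iota>, so
    the bound is uniform in the index set. N0 = 2 ensures that the sphere sits in a space of
    dimension N - 1 >= 1.\<close>
  show ?thesis
  proof (intro exI[of _ "C * (50 * real CARD('k) * s\<^sup>2 + 1 + 2 * real CARD('k) * (4 ^ p * (m ^ (2 * p) + s ^ (2 * p) * (2 * 8 ^ p * gmom p))))"]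
      exI[of _ 2] allI impI)
    fix N and \<iota> :: "'k \<Rightarrow> nat" assume N: "2 \<le> N" and "inj \<iota> \<and> range \<iota> \<subseteq> {..<N}"
    then have \<iota>: "range \<iota> \<subseteq> {..<N}" by simp
    then have \<iota>N: "\<iota> i < N" for i by auto
    have mc: "mc_measure N m \<rho> = distr (gaussN N) (lebN N) (\<lambda>x. \<lambda>j\<in>{..<N}. m + s * mc_field N x j)"
      using mc_measure_eq_gauss[OF N _ s(2)] s(1) by simp
    have gc: "gc_measure N \<mu> \<eta> = distr (gaussN N) (lebN N) (\<lambda>x. \<lambda>j\<in>{..<N}. m + s * gc_field N x j)"
      using gc_measure_eq_distr[OF s(1), of \<mu> m \<eta> N] distr_gaussN_gc_field[of N m s] N assms(3,4) s(2) by simp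
    \<comment> \<open>Integrals against either ensemble are pulled back to the common Gaussian
      space, where the two test functions can be subtracted pointwise.\<close>
    have tr: "(\<integral>\<phi>. f (proj_I \<iota> \<phi>) \<partial>distr (gaussN N) (lebN N) (\<lambda>x. \<lambda>j\<in>{..<N}. m + s * F x j))
        = (\<integral>x. f (\<chi> i. m + s * F x (\<iota> i)) \<partial>gaussN N)"
      if "\<And>j. (\<lambda>x. F x j) \<in> borel_measurable (lebN N)" for F
    proof -
      have 1: "(\<lambda>x. \<lambda>j\<in>{..<N}. m + s * F x j) \<in> measurable (gaussN N) (lebN N)"
        using that by (intro measurable_into_lebN) (auto simp: measurable_cong_sets[OF sets_gaussN refl])
      have 2: "(\<lambda>\<phi>. f (proj_I \<iota> \<phi>)) \<in> borel_measurable (lebN N)"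
        using measurable_proj_I[OF \<iota>] by measurable
      show ?thesis
        unfolding integral_distr[OF 1 2] by (simp add: proj_I_def \<iota>N)
    qed
    show "\<bar>(\<integral>\<phi>. f (proj_I \<iota> \<phi>) \<partial>mc_measure N m \<rho>) - (\<integral>\<phi>. f (proj_I \<iota> \<phi>) \<partial>gc_measure N \<mu> \<eta>)\<bar>
      \<le> C * (50 * real CARD('k) * s\<^sup>2 + 1 + 2 * real CARD('k) * (4 ^ p * (m ^ (2 * p) + s ^ (2 * p) * (2 * 8 ^ p * gmom p)))) / sqrt (real N)"
      unfolding mc gc using N by (subst (1 2) tr) (auto intro!: sq_growth_field_diff[OF f _ N \<iota>])
  qed
qed

end
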